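(* Let $n\geq1$. The polarized traces $T^{(i,j)}$ with $1\leq i\leq j\leq n$ and $T^{(i,j,k)}$ with $1\leq i<j<k\leq n$ generate, as an algebra, the centralizer $Z_n(\mathfrak{sl}_2)$ of the diagonal action of $U(\mathfrak{sl}_2)$ in $U(\mathfrak{sl}_2)^{\otimes n}$.
   Context: Everything is over $\mathbb{C}$. $\mathfrak{sl}_2$ is spanned by $e_{ij}$, $i,j\in\{1,2\}$, with $[e_{ij},e_{k\ell}]=\delta_{jk}e_{i\ell}-\delta_{\ell i}e_{kj}$ and $e_{11}+e_{22}=0$. In $U(\mathfrak{sl}_2)^{\otimes n}$ write $e_{ij}^{(a)}=1^{\otimes(a-1)}\otimes e_{ij}\otimes 1^{\otimes(n-a)}$. The diagonal embedding is the algebra map $\delta:U(\mathfrak{sl}_2)\to U(\mathfrak{sl}_2)^{\otimes n}$, $e_{ij}\mapsto\sum_{a=1}^n e_{ij}^{(a)}$. The centralizer is $Z_n(\mathfrak{sl}_2)=\{X\in U(\mathfrak{sl}_2)^{\otimes n} : [\delta(g),X]=0\ \forall g\in U(\mathfrak{sl}_2)\}$. The polarized traces are $$T^{(a_1,\dots,a_d)}=\sum_{i_1,\dots,i_d\in\{1,2\}}e_{i_2i_1}^{(a_1)}e_{i_3i_2}^{(a_2)}\cdots e_{i_1i_d}^{(a_d)},\qquad a_1,\dots,a_d\in\{1,\dots,n\};$$ they are elements of $Z_n(\mathfrak{sl}_2)$. *)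

theory Defs
  imports Complex_Main "HOL-Library.Poly_Mapping" "HOL-Library.Numeral_Type"
begin

section \<open>Associative unital algebras over the complex numbers\<close>

class complex_algebra = ring + monoid_mult +
  fixes scaleC :: "complex \<Rightarrow> 'a \<Rightarrow> 'a"
  assumes scaleC_add_right: "scaleC c (x + y) = scaleC c x + scaleC c y"
    and scaleC_add_left: "scaleC (c + d) x = scaleC c x + scaleC d x"
    and scaleC_scaleC: "scaleC c (scaleC d x) = scaleC (c * d) x"
    and scaleC_one: "scaleC 1 x = x"
    and mult_scaleC_left: "scaleC c x * y = scaleC c (x * y)"
    and mult_scaleC_right: "x * scaleC c y = scaleC c (x * y)"

global_interpretation scaleC: vector_space "scaleC :: complex \<Rightarrow> 'a::complex_algebra \<Rightarrow> 'a"
  by standard (rule scaleC_add_right scaleC_add_left scaleC_scaleC scaleC_one)+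

definition is_subalgebra :: "'a::complex_algebra set \<Rightarrow> bool" where
  "is_subalgebra A \<longleftrightarrow> 0 \<in> A \<and> 1 \<in> A \<and>
     (\<forall>x\<in>A. \<forall>y\<in>A. x + y \<in> A) \<and> (\<forall>x\<in>A. \<forall>y\<in>A. x * y \<in> A) \<and>
     (\<forall>c. \<forall>x\<in>A. scaleC c x \<in> A)"

abbreviation generated_algebra :: "'a::complex_algebra set \<Rightarrow> 'a set" where
  "generated_algebra S \<equiv> is_subalgebra hull S"


section \<open>Two-sided ideals\<close>

definition two_sided_ideal :: "'a::ring set \<Rightarrow> bool" where
  "two_sided_ideal I \<longleftrightarrow> 0 \<in> I \<and> (\<forall>x\<in>I. \<forall>y\<in>I. x - y \<in> I) \<and>
     (\<forall>x\<in>I. \<forall>r. r * x \<in> I \<and> x * r \<in> I)"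

lemma two_sided_ideal_hull: "two_sided_ideal (two_sided_ideal hull S)"
  by (rule hull_in) (auto simp: two_sided_ideal_def)

lemma two_sided_idealD:
  assumes "two_sided_ideal I"
  shows "0 \<in> I" "x \<in> I \<Longrightarrow> y \<in> I \<Longrightarrow> x - y \<in> I" "x \<in> I \<Longrightarrow> r * x \<in> I" "x \<in> I \<Longrightarrow> x * r \<in> I"
    "x \<in> I \<Longrightarrow> - x \<in> I" "x \<in> I \<Longrightarrow> y \<in> I \<Longrightarrow> x + y \<in> I"
proof -
  show 0: "0 \<in> I" and d: "\<And>x y. x \<in> I \<Longrightarrow> y \<in> I \<Longrightarrow> x - y \<in> I"
    and "x \<in> I \<Longrightarrow> r * x \<in> I" "x \<in> I \<Longrightarrow> x * r \<in> I"
    using assms by (auto simp: two_sided_ideal_def)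
  show n: "\<And>x. x \<in> I \<Longrightarrow> - x \<in> I" using d[OF 0] by simp
  show "x \<in> I \<Longrightarrow> y \<in> I \<Longrightarrow> x + y \<in> I" using d[OF _ n, of x y] by simp
qed

definition cong_mod :: "'a::ring set \<Rightarrow> 'a \<Rightarrow> 'a \<Rightarrow> bool" where
  "cong_mod I x y \<longleftrightarrow> x - y \<in> I"

lemma equivp_cong_mod:
  assumes "two_sided_ideal I"
  shows "equivp (cong_mod I)"
proof (rule equivpI)
  note I = two_sided_idealD[OF assms]
  show "reflp (cong_mod I)" by (rule reflpI) (simp add: cong_mod_def I(1))
  show "symp (cong_mod I)"
    by (rule sympI) (metis I(5) cong_mod_def minus_diff_eq)
  show "transp (cong_mod I)"
    by (rule transpI) (metis I(6) cong_mod_def diff_add_cancel add_diff_eq)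
qed

lemma cong_mod_arith:
  assumes "two_sided_ideal I" "cong_mod I x x'"
  shows "cong_mod I y y' \<Longrightarrow> cong_mod I (x + y) (x' + y')"
    and "cong_mod I y y' \<Longrightarrow> cong_mod I (x - y) (x' - y')"
    and "cong_mod I y y' \<Longrightarrow> cong_mod I (x * y) (x' * y')"
    and "cong_mod I (- x) (- x')"
    and "cong_mod I (r * x) (r * x')"
proof -
  note I = two_sided_idealD[OF assms(1)]
  show "cong_mod I (x + y) (x' + y')" if "cong_mod I y y'"
    using I(6)[of "x - x'" "y - y'"] assms(2) that by (simp add: cong_mod_def algebra_simps)
  show "cong_mod I (x - y) (x' - y')" if "cong_mod I y y'"
    using I(2)[of "x - x'" "y - y'"] assms(2) that by (simp add: cong_mod_def algebra_simps)
  show "cong_mod I (x * y) (x' * y')" if "cong_mod I y y'"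
    using I(6)[OF I(4)[of "x - x'" y] I(3)[of "y - y'" x']] assms(2) that
    by (simp add: cong_mod_def algebra_simps)
  show "cong_mod I (- x) (- x')"
    using I(5)[of "x - x'"] assms(2) by (simp add: cong_mod_def)
  show "cong_mod I (r * x) (r * x')"
    using I(3)[of "x - x'" r] assms(2) by (simp add: cong_mod_def algebra_simps)
qed


section \<open>Monoid algebras and free algebras\<close>

text \<open>
  For a (not necessarily commutative) monoid written additively, the type
  \<open>'m \<Rightarrow>\<^sub>0 complex\<close> with its convolution product is the monoid algebra.
\<close>

abbreviation monom :: "'m \<Rightarrow> 'm \<Rightarrow>\<^sub>0 complex" where
  "monom m \<equiv> Poly_Mapping.single m 1"

abbreviation scalar :: "complex \<Rightarrow> 'm::monoid_add \<Rightarrow>\<^sub>0 complex" where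
  "scalar c \<equiv> Poly_Mapping.single 0 c"

lemma const_central: "p * scalar c = scalar c * (p :: 'm::monoid_add \<Rightarrow>\<^sub>0 complex)"
proof (induction p rule: update_induct)
  case const
  then show ?case by simp
next
  case (update f a b)
  then have "Poly_Mapping.update a b f = f + Poly_Mapping.single a b"
    by (intro poly_mapping_eqI)
      (auto simp: Poly_Mapping.lookup_update lookup_add lookup_single when_def
        not_in_keys_iff_lookup_eq_zero)
  with update show ?case by (simp add: distrib_left distrib_right mult_single mult.commute)
qed

lemma monoid_algebra_expand:
  "p = (\<Sum>m\<in>Poly_Mapping.keys p. Poly_Mapping.single m (Poly_Mapping.lookup p m))"
  by (intro poly_mapping_eqI)
    (simp add: lookup_sum lookup_single when_def in_keys_iff)

datatype 'g free_monoid = Letters (letters: "'g list")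

instantiation free_monoid :: (type) monoid_add
begin
definition zero_free_monoid :: "'a free_monoid" where "0 = Letters []"
definition plus_free_monoid :: "'a free_monoid \<Rightarrow> 'a free_monoid \<Rightarrow> 'a free_monoid" where
  "v + w = Letters (letters v @ letters w)"
instance by standard (simp_all add: zero_free_monoid_def plus_free_monoid_def)
end

type_synonym 'g free_algebra = "'g free_monoid \<Rightarrow>\<^sub>0 complex"

definition free_gen :: "'g \<Rightarrow> 'g free_algebra" where
  "free_gen g = monom (Letters [g])"

text \<open>The algebra homomorphism out of the free algebra with prescribed values on generators.\<close>

definition free_eval :: "('g \<Rightarrow> 'a::complex_algebra) \<Rightarrow> 'g free_algebra \<Rightarrow> 'a" where
  "free_eval f p = (\<Sum>w\<in>Poly_Mapping.keys p.
     scaleC (Poly_Mapping.lookup p w) (prod_list (map f (letters w))))"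

lemma free_eval_superset:
  assumes "finite W" "Poly_Mapping.keys p \<subseteq> W"
  shows "free_eval f p = (\<Sum>w\<in>W. scaleC (Poly_Mapping.lookup p w) (prod_list (map f (letters w))))"
  unfolding free_eval_def using assms
  by (intro sum.mono_neutral_left) (auto simp: in_keys_iff)

lemma free_eval_add: "free_eval f (p + q) = free_eval f p + free_eval f q"
proof -
  let ?W = "Poly_Mapping.keys p \<union> Poly_Mapping.keys q"
  have "finite ?W" "Poly_Mapping.keys (p + q) \<subseteq> ?W" using Poly_Mapping.keys_add[of p q] by auto
  then show ?thesis
    by (simp add: free_eval_superset[of ?W] lookup_add scaleC.scale_left_distrib sum.distrib)
qed

lemma free_eval_zero: "free_eval f 0 = 0"
  by (simp add: free_eval_def)

lemma free_eval_uminus: "free_eval f (- p) = - free_eval f p"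
  using free_eval_add[of f p "- p"] by (simp add: free_eval_zero eq_neg_iff_add_eq_0 add.commute)

lemma free_eval_diff: "free_eval f (p - q) = free_eval f p - free_eval f q"
  using free_eval_add[of f p "- q"] by (simp add: free_eval_uminus)

lemma free_eval_single:
  "free_eval f (Poly_Mapping.single w c) = scaleC c (prod_list (map f (letters w)))"
  by (simp add: free_eval_def)

lemma free_eval_sum: "free_eval f (sum h S) = (\<Sum>s\<in>S. free_eval f (h s))"
  by (induction S rule: infinite_finite_induct) (simp_all add: free_eval_zero free_eval_add)

lemma free_eval_mult: "free_eval f (p * q) = free_eval f p * free_eval f q"
proof -
  have s: "free_eval f (Poly_Mapping.single v c * Poly_Mapping.single w d) =
      free_eval f (Poly_Mapping.single v c) * free_eval f (Poly_Mapping.single w d)" for v w c d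
    by (simp add: mult_single free_eval_single plus_free_monoid_def mult_scaleC_left
        mult_scaleC_right scaleC_scaleC mult.commute)
  show ?thesis
    by (subst (1 2) monoid_algebra_expand[of p], subst (1 2) monoid_algebra_expand[of q])
      (simp add: sum_product free_eval_sum s)
qed

lemma free_eval_const: "free_eval f (scalar c) = scaleC c 1"
  by (simp add: free_eval_single zero_free_monoid_def)

lemma free_eval_one: "free_eval f 1 = 1"
  using free_eval_const[of f 1] by (simp add: scaleC_one)

lemma free_eval_gen: "free_eval f (free_gen g) = f g"
  by (simp add: free_gen_def free_eval_single scaleC_one)

lemma free_eval_ideal:
  assumes "\<And>r. r \<in> R \<Longrightarrow> free_eval f r = 0" "p \<in> two_sided_ideal hull R"
  shows "free_eval f p = 0"
proof -
  have "two_sided_ideal {p. free_eval f p = 0}"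
    by (simp add: two_sided_ideal_def free_eval_zero free_eval_diff free_eval_mult)
  then have "two_sided_ideal hull R \<subseteq> {p. free_eval f p = 0}"
    using assms(1) by (intro hull_minimal) auto
  with assms(2) show ?thesis by auto
qed


section \<open>The universal enveloping algebra of $\mathfrak{sl}_2$\<close>

text \<open>
  The Lie algebra is given by the spanning set \<open>e\<^sub>i\<^sub>j\<close>, with indices in the
  two-element type \<open>2\<close> (its elements are \<open>1\<close> and \<open>2 = 0\<close>), subject to the commutation relations and
  \<open>e\<^sub>1\<^sub>1 + e\<^sub>2\<^sub>2 = 0\<close>; its enveloping algebra is the free algebra on the \<open>e\<^sub>i\<^sub>j\<close>
  modulo these relations, the bracket being read as a commutator.
\<close>

definition sl2_relations :: "(2 \<times> 2) free_algebra set" where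
  "sl2_relations =
     {free_gen (i, j) * free_gen (k, l) - free_gen (k, l) * free_gen (i, j)
       - ((if j = k then free_gen (i, l) else 0) - (if l = i then free_gen (k, j) else 0))
      | i j k l. True} \<union>
     {free_gen (1, 1) + free_gen (2, 2)}"

definition sl2_cong :: "(2 \<times> 2) free_algebra \<Rightarrow> (2 \<times> 2) free_algebra \<Rightarrow> bool" where
  "sl2_cong = cong_mod (two_sided_ideal hull sl2_relations)"

quotient_type usl2 = "(2 \<times> 2) free_algebra" / sl2_cong
  unfolding sl2_cong_def by (rule equivp_cong_mod[OF two_sided_ideal_hull])

instantiation usl2 :: complex_algebra
begin

lift_definition zero_usl2 :: usl2 is 0 .
lift_definition one_usl2 :: usl2 is 1 .
lift_definition plus_usl2 :: "usl2 \<Rightarrow> usl2 \<Rightarrow> usl2" is "(+)"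
  unfolding sl2_cong_def by (rule cong_mod_arith[OF two_sided_ideal_hull])
lift_definition minus_usl2 :: "usl2 \<Rightarrow> usl2 \<Rightarrow> usl2" is "(-)"
  unfolding sl2_cong_def by (rule cong_mod_arith[OF two_sided_ideal_hull])
lift_definition uminus_usl2 :: "usl2 \<Rightarrow> usl2" is uminus
  unfolding sl2_cong_def by (rule cong_mod_arith[OF two_sided_ideal_hull])
lift_definition times_usl2 :: "usl2 \<Rightarrow> usl2 \<Rightarrow> usl2" is "(*)"
  unfolding sl2_cong_def by (rule cong_mod_arith[OF two_sided_ideal_hull])
lift_definition scaleC_usl2 :: "complex \<Rightarrow> usl2 \<Rightarrow> usl2" is "\<lambda>c p. scalar c * p"
  unfolding sl2_cong_def by (rule cong_mod_arith[OF two_sided_ideal_hull])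

instance
proof
  note refl = equivp_reflp[OF usl2_equivp]
  fix a b c :: usl2 and s t :: complex
  show "a + b + c = a + (b + c)" by transfer (simp add: add.assoc refl)
  show "a + b = b + a" by transfer (simp add: add.commute refl)
  show "0 + a = a" by transfer (simp add: refl)
  show "- a + a = 0" by transfer (simp add: refl)
  show "a - b = a + - b" by transfer (simp add: refl)
  show "a * b * c = a * (b * c)" by transfer (simp add: mult.assoc refl)
  show "(a + b) * c = a * c + b * c" by transfer (simp add: distrib_right refl)
  show "a * (b + c) = a * b + a * c" by transfer (simp add: distrib_left refl)
  show "1 * a = a" by transfer (simp add: refl)
  show "a * 1 = a" by transfer (simp add: refl)
  show "scaleC s (a + b) = scaleC s a + scaleC s b" by transfer (simp add: distrib_left refl)
  show "scaleC (s + t) a = scaleC s a + scaleC t a"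
    by transfer (simp add: single_add distrib_right refl)
  show "scaleC s (scaleC t a) = scaleC (s * t) a"
    by transfer (simp add: mult.assoc[symmetric] mult_single refl)
  show "scaleC 1 a = a" by transfer (simp add: refl)
  show "scaleC s a * b = scaleC s (a * b)" by transfer (simp add: mult.assoc refl)
  show "a * scaleC s b = scaleC s (a * b)"
    by transfer (simp add: mult.assoc[symmetric] const_central refl)
qed

end

lift_definition sl2_e :: "2 \<Rightarrow> 2 \<Rightarrow> usl2" is "\<lambda>i j. free_gen (i, j)" .

lemma usl2_relI: "p - q \<in> sl2_relations \<Longrightarrow> sl2_cong p q"
  by (simp add: sl2_cong_def cong_mod_def hull_inc)

lemma sl2_e_commutator:
  "sl2_e i j * sl2_e k l - sl2_e k l * sl2_e i j = (if j = k then sl2_e i l else 0) - (if l = i then sl2_e k j else 0)"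
  (is "?lhs = ?rhs")
proof -
  let ?r = "if j = k then free_gen (i, l) else 0" and ?s = "if l = i then free_gen (k, j) else 0"
  have "?rhs = abs_usl2 (?r - ?s)"
    by (simp add: sl2_e.abs_eq zero_usl2.abs_eq minus_usl2.abs_eq)
  moreover have "?lhs = abs_usl2 (?r - ?s)"
    unfolding sl2_e.abs_eq times_usl2.abs_eq minus_usl2.abs_eq usl2.abs_eq_iff
    by (intro usl2_relI) (unfold sl2_relations_def, blast)
  ultimately show ?thesis by simp
qed

lemma sl2_e_trace: "sl2_e 1 1 + sl2_e 2 2 = 0"
  by transfer (intro usl2_relI, simp add: sl2_relations_def)


section \<open>Tensor powers of an algebra\<close>

text \<open>
  The tensor power of \<open>'a\<close> with factors indexed by \<open>'n\<close> is the free vector space on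
  \<open>'n\<close>-tuples modulo multilinearity. Tuples form a monoid under the factorwise product of \<open>'a\<close>
  (written additively, see above), so the free vector space is a monoid algebra. The multilinearity
  relations are mapped to such relations (or to 0) by multiplication with a tuple on either side,
  hence their linear span is already a two-sided ideal.
\<close>

datatype ('a, 'n) tuple = Tuple (component: "'n \<Rightarrow> 'a")

instantiation tuple :: (monoid_mult, type) monoid_add
begin
definition zero_tuple :: "('a, 'b) tuple" where "0 = Tuple (\<lambda>_. 1)"
definition plus_tuple :: "('a, 'b) tuple \<Rightarrow> ('a, 'b) tuple \<Rightarrow> ('a, 'b) tuple" where
  "s + t = Tuple (\<lambda>a. component s a * component t a)"
instance by standard (simp_all add: zero_tuple_def plus_tuple_def mult.assoc)
end

type_synonym ('a, 'n) tuple_algebra = "('a, 'n) tuple \<Rightarrow>\<^sub>0 complex"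

definition multilinearity :: "('a::complex_algebra, 'n) tuple_algebra set" where
  "multilinearity =
     {monom (Tuple (f(a := u + v))) - monom (Tuple (f(a := u))) - monom (Tuple (f(a := v)))
      | f a u v. True} \<union>
     {monom (Tuple (f(a := scaleC c u))) - scalar c * monom (Tuple (f(a := u)))
      | f a c u. True}"

definition tensor_cong ::
  "('a::complex_algebra, 'n) tuple_algebra \<Rightarrow> ('a, 'n) tuple_algebra \<Rightarrow> bool" where
  "tensor_cong = cong_mod (two_sided_ideal hull multilinearity)"

quotient_type (overloaded) ('a, 'n) tensor_power =
    "('a::complex_algebra, 'n) tuple_algebra" / tensor_cong
  unfolding tensor_cong_def by (rule equivp_cong_mod[OF two_sided_ideal_hull])

instantiation tensor_power :: (complex_algebra, type) complex_algebra
begin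

lift_definition zero_tensor_power :: "('a, 'b) tensor_power" is 0 .
lift_definition one_tensor_power :: "('a, 'b) tensor_power" is 1 .
lift_definition plus_tensor_power ::
    "('a, 'b) tensor_power \<Rightarrow> ('a, 'b) tensor_power \<Rightarrow> ('a, 'b) tensor_power" is "(+)"
  unfolding tensor_cong_def by (rule cong_mod_arith[OF two_sided_ideal_hull])
lift_definition minus_tensor_power ::
    "('a, 'b) tensor_power \<Rightarrow> ('a, 'b) tensor_power \<Rightarrow> ('a, 'b) tensor_power" is "(-)"
  unfolding tensor_cong_def by (rule cong_mod_arith[OF two_sided_ideal_hull])
lift_definition uminus_tensor_power ::
    "('a, 'b) tensor_power \<Rightarrow> ('a, 'b) tensor_power" is uminus
  unfolding tensor_cong_def by (rule cong_mod_arith[OF two_sided_ideal_hull])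
lift_definition times_tensor_power ::
    "('a, 'b) tensor_power \<Rightarrow> ('a, 'b) tensor_power \<Rightarrow> ('a, 'b) tensor_power" is "(*)"
  unfolding tensor_cong_def by (rule cong_mod_arith[OF two_sided_ideal_hull])
lift_definition scaleC_tensor_power ::
    "complex \<Rightarrow> ('a, 'b) tensor_power \<Rightarrow> ('a, 'b) tensor_power" is "\<lambda>c p. scalar c * p"
  unfolding tensor_cong_def by (rule cong_mod_arith[OF two_sided_ideal_hull])

instance
proof
  note refl = equivp_reflp[OF tensor_power_equivp]
  fix a b c :: "('a, 'b) tensor_power" and s t :: complex
  show "a + b + c = a + (b + c)" by transfer (simp add: add.assoc refl)
  show "a + b = b + a" by transfer (simp add: add.commute refl)
  show "0 + a = a" by transfer (simp add: refl)
  show "- a + a = 0" by transfer (simp add: refl)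
  show "a - b = a + - b" by transfer (simp add: refl)
  show "a * b * c = a * (b * c)" by transfer (simp add: mult.assoc refl)
  show "(a + b) * c = a * c + b * c" by transfer (simp add: distrib_right refl)
  show "a * (b + c) = a * b + a * c" by transfer (simp add: distrib_left refl)
  show "1 * a = a" by transfer (simp add: refl)
  show "a * 1 = a" by transfer (simp add: refl)
  show "scaleC s (a + b) = scaleC s a + scaleC s b" by transfer (simp add: distrib_left refl)
  show "scaleC (s + t) a = scaleC s a + scaleC t a"
    by transfer (simp add: single_add distrib_right refl)
  show "scaleC s (scaleC t a) = scaleC (s * t) a"
    by transfer (simp add: mult.assoc[symmetric] mult_single refl)
  show "scaleC 1 a = a" by transfer (simp add: refl)
  show "scaleC s a * b = scaleC s (a * b)" by transfer (simp add: mult.assoc refl)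
  show "a * scaleC s b = scaleC s (a * b)"
    by transfer (simp add: mult.assoc[symmetric] const_central refl)
qed

end

lift_definition pure_tensor :: "('n \<Rightarrow> 'a::complex_algebra) \<Rightarrow> ('a, 'n) tensor_power"
  is "\<lambda>f. monom (Tuple f)" .

lemma pure_tensor_mult: "pure_tensor f * pure_tensor g = pure_tensor (\<lambda>a. f a * g a)"
  by transfer (simp add: mult_single plus_tuple_def equivp_reflp[OF tensor_power_equivp])

lemma pure_tensor_one: "pure_tensor (\<lambda>_. 1) = 1"
  by transfer (simp add: zero_tuple_def[symmetric] equivp_reflp[OF tensor_power_equivp])

lemma pure_tensor_add:
  "pure_tensor (f(a := u + v)) = pure_tensor (f(a := u)) + pure_tensor (f(a := v))"
  by transfer (unfold tensor_cong_def cong_mod_def, rule hull_inc,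
      unfold multilinearity_def diff_diff_eq[symmetric], blast)

lemma pure_tensor_scaleC: "pure_tensor (f(a := scaleC c u)) = scaleC c (pure_tensor (f(a := u)))"
  by transfer (unfold tensor_cong_def cong_mod_def, rule hull_inc,
      unfold multilinearity_def, blast)

definition in_factor :: "'n \<Rightarrow> 'a::complex_algebra \<Rightarrow> ('a, 'n) tensor_power" where
  "in_factor a u = pure_tensor ((\<lambda>_. 1)(a := u))"

lemma in_factor_one: "in_factor a 1 = 1"
  by (simp add: in_factor_def fun_upd_idem pure_tensor_one)

lemma in_factor_add: "in_factor a (u + v) = in_factor a u + in_factor a v"
  by (simp add: in_factor_def pure_tensor_add)

lemma in_factor_scaleC: "in_factor a (scaleC c u) = scaleC c (in_factor a u)"
  by (simp add: in_factor_def pure_tensor_scaleC)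

lemma in_factor_mult: "in_factor a (u * v) = in_factor a u * in_factor a v"
  by (auto simp: in_factor_def pure_tensor_mult intro!: arg_cong[of _ _ pure_tensor])

lemma in_factor_commute: "a \<noteq> b \<Longrightarrow> in_factor a u * in_factor b v = in_factor b v * in_factor a u"
  by (auto simp: in_factor_def pure_tensor_mult intro!: arg_cong[of _ _ pure_tensor])

lemma in_factor_zero: "in_factor a 0 = 0"
  using in_factor_add[of a 0 0] by simp

lemma in_factor_diff: "in_factor a (u - v) = in_factor a u - in_factor a v"
  using in_factor_add[of a "u - v" v] by (simp add: algebra_simps)


section \<open>The diagonal embedding, the centralizer and polarized traces\<close>

text \<open>
  The number of tensor factors is $n = $ \<open>CARD('n)\<close>, which is automatically positive; when
  the order of the factors matters, \<open>'n\<close> is moreover linearly ordered.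
\<close>

lemma sl2_diagonal_relations:
  assumes "r \<in> sl2_relations"
  shows "free_eval (\<lambda>(i, j). \<Sum>a\<in>(UNIV :: 'n::finite set). in_factor a (sl2_e i j)) r = 0"
proof -
  let ?d = "\<lambda>i j. \<Sum>a\<in>(UNIV :: 'n set). in_factor a (sl2_e i j)"
  note ev = free_eval_diff free_eval_add free_eval_mult free_eval_gen free_eval_zero
  have comm: "?d i j * ?d k l - ?d k l * ?d i j =
      (if j = k then ?d i l else 0) - (if l = i then ?d k j else 0)" for i j k l
  proof -
    have "?d i j * ?d k l - ?d k l * ?d i j = (\<Sum>a\<in>UNIV. \<Sum>b\<in>UNIV.
        in_factor a (sl2_e i j) * in_factor b (sl2_e k l) - in_factor b (sl2_e k l) * in_factor a (sl2_e i j))"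
      by (simp add: sum_product sum_subtractf) (rule sum.swap)
    also have "\<dots> = (\<Sum>a\<in>UNIV. \<Sum>b\<in>UNIV.
        if b = a then in_factor a (sl2_e i j * sl2_e k l - sl2_e k l * sl2_e i j) else 0)"
      by (intro sum.cong refl) (auto simp: in_factor_diff in_factor_mult in_factor_commute)
    also have "\<dots> = (\<Sum>a\<in>UNIV. in_factor a (sl2_e i j * sl2_e k l - sl2_e k l * sl2_e i j))"
      by simp
    also have "\<dots> = (if j = k then ?d i l else 0) - (if l = i then ?d k j else 0)"
      by (simp add: sl2_e_commutator in_factor_diff in_factor_zero sum_subtractf)
    finally show ?thesis .
  qed
  have tr: "?d 1 1 + ?d 2 2 = 0"
    by (simp add: sum.distrib[symmetric] in_factor_add[symmetric] sl2_e_trace in_factor_zero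
        del: sum.distrib)
  from assms show ?thesis
    unfolding sl2_relations_def
  proof (elim UnE)
    assume "r \<in> {free_gen (i, j) * free_gen (k, l) - free_gen (k, l) * free_gen (i, j)
       - ((if j = k then free_gen (i, l) else 0) - (if l = i then free_gen (k, j) else 0))
      | i j k l. True}"
    then obtain i j k l where "r = free_gen (i, j) * free_gen (k, l) - free_gen (k, l) * free_gen (i, j)
       - ((if j = k then free_gen (i, l) else 0) - (if l = i then free_gen (k, j) else 0))"
      by blast
    then show ?thesis using comm[of i j k l] by (auto simp: ev split: if_splits)
  next
    assume "r \<in> {free_gen (1, 1) + free_gen (2, 2)}"
    then show ?thesis using tr by (simp add: ev)
  qed
qed

lift_definition diagonal :: "usl2 \<Rightarrow> (usl2, 'n::finite) tensor_power"
  is "free_eval (\<lambda>(i, j). \<Sum>a\<in>UNIV. in_factor a (sl2_e i j))"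
  using free_eval_ideal[OF sl2_diagonal_relations]
  by (fastforce simp: sl2_cong_def cong_mod_def free_eval_diff)

lemma diagonal_e: "diagonal (sl2_e i j) = (\<Sum>a\<in>UNIV. in_factor a (sl2_e i j))"
  by transfer (simp add: free_eval_gen)

lemma diagonal_hom:
  "diagonal (x + y) = diagonal x + diagonal y"
  "diagonal (x * y) = diagonal x * diagonal y"
  "diagonal 1 = 1"
  "diagonal (scaleC c x) = scaleC c (diagonal x)"
  by (transfer; simp add: free_eval_add free_eval_mult free_eval_one free_eval_const
      mult_scaleC_left)+

definition centralizer :: "(usl2, 'n::finite) tensor_power set" where
  "centralizer = {X. \<forall>g. diagonal g * X - X * diagonal g = 0}"

text \<open>
  The polarized trace of the sequence \<open>as = [a\<^sub>1, \<dots>, a\<^sub>d]\<close>. The list \<open>is = [i\<^sub>1, \<dots>, i\<^sub>d]\<close>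
  holds the summation indices; positions are counted from 0, and the index following \<open>i\<^sub>d\<close>
  is \<open>i\<^sub>1\<close>.
\<close>

definition polarized_trace :: "'n list \<Rightarrow> (usl2, 'n::finite) tensor_power" where
  "polarized_trace as = (\<Sum>is | length is = length as.
     \<Prod>k\<leftarrow>[0..<length as]. in_factor (as ! k) (sl2_e (is ! (Suc k mod length as)) (is ! k)))"

lemma sum_lists_Suc:
  "(\<Sum>is | length is = Suc d. h is) = (\<Sum>i\<in>UNIV. \<Sum>is | length is = d. h (i # is))"
  for h :: "'i::finite list \<Rightarrow> 'b::comm_monoid_add"
proof -
  have "{is :: 'i list. length is = Suc d} = (\<lambda>(i, is). i # is) ` (UNIV \<times> {is. length is = d})"
    by (auto simp: length_Suc_conv image_iff)
  moreover have "inj_on (\<lambda>(i, is). i # is) (UNIV \<times> {is :: 'i list. length is = d})"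
    by (auto simp: inj_on_def)
  ultimately show ?thesis
    by (simp add: sum.reindex sum.cartesian_product case_prod_unfold)
qed

lemma polarized_trace_2:
  "polarized_trace [a, b] =
     (\<Sum>i\<in>UNIV. \<Sum>j\<in>UNIV. in_factor a (sl2_e j i) * in_factor b (sl2_e i j))"
  by (simp add: polarized_trace_def sum_lists_Suc)

lemma polarized_trace_3:
  "polarized_trace [a, b, c] =
     (\<Sum>i\<in>UNIV. \<Sum>j\<in>UNIV. \<Sum>k\<in>UNIV.
        in_factor a (sl2_e j i) * in_factor b (sl2_e k j) * in_factor c (sl2_e i k))"
  by (simp add: polarized_trace_def sum_lists_Suc mult.assoc)

end

theory Submission
  imports Defs "HOL-Analysis.Cartesian_Space"
begin

text \<open>
  In the basis \<open>x\<^sub>1, x\<^sub>2, x\<^sub>3\<close> with brackets \<open>[x\<^sub>i, x\<^sub>j] = \<Sum>k. \<epsilon>\<^sub>i\<^sub>j\<^sub>k x\<^sub>k\<close>, the polarized traces of lengths 2 and 3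
  are \<open>-2\<close> times the dot products and \<open>2\<close> times the triple products of the vectors \<open>x\<^sup>(\<^sup>a\<^sup>)\<close>, and the
  centralizer is the space of invariants of the diagonal rotations \<open>D\<^sub>i\<close>. Filter the tensor power by
  degree; commutators drop the degree. Consider a product of dot and triple products with components of
  \<open>m\<close> vectors, each an \<open>x\<^sup>(\<^sup>a\<^sup>)\<close> or an \<open>x\<^sup>(\<^sup>a\<^sup>) \<times> x\<^sup>(\<^sup>b\<^sup>)\<close>. The Casimir operator \<open>\<Sum>i. D\<^sub>i\<^sup>2\<close> multiplies it by
  \<open>-m(m+1)\<close>, up to lower degree and up to terms in which two of the vectors have been contracted to their
  dot product or their cross product; the double cross product formulas turn these into products of the
  same kind with fewer vectors. The Casimir operator kills an invariant, so an
  invariant combination of such products can be rewritten with fewer and fewer vectors, until only dot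
  and triple products remain, modulo lower degree. Working in the filtered algebra itself makes
  complete reducibility and the Poincare-Birkhoff-Witt theorem unnecessary.
\<close>

section \<open>Linear and bilinear maps on spans\<close>

text \<open>The maps used later are expressions such as a commutator with a fixed element, so
  linearity is stated as equations that the simplifier can check.\<close>

lemma span_image_in_subspace:
  assumes "y \<in> scaleC.span S" and "scaleC.subspace W"
    and add: "\<And>y z. f (y + z) = f y + f z" and scale: "\<And>c y. f (scaleC c y) = scaleC c (f y)"
    and "\<And>s. s \<in> S \<Longrightarrow> f s \<in> W"
  shows "f y \<in> W"
  using assms(1)
proof (induction rule: scaleC.span_induct)
  case base
  have "f 0 = 0" using scale[of 0 0] by simp
  then show ?case
    using assms(2) by (auto simp: scaleC.subspace_def add scale)
next
  case (step s)
  then show ?case using assms(5) by simp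
qed

lemma span_bilinear_in_subspace:
  assumes "y \<in> scaleC.span S" and "z \<in> scaleC.span T" and "scaleC.subspace W"
    and "\<And>y y' z. f (y + y') z = f y z + f y' z" and "\<And>y z z'. f y (z + z') = f y z + f y z'"
    and "\<And>c y z. f (scaleC c y) z = scaleC c (f y z)" and "\<And>c y z. f y (scaleC c z) = scaleC c (f y z)"
    and "\<And>s t. s \<in> S \<Longrightarrow> t \<in> T \<Longrightarrow> f s t \<in> W"
  shows "f y z \<in> W"
proof (rule span_image_in_subspace[OF assms(1,3)])
  show "f s z \<in> W" if "s \<in> S" for s
    by (rule span_image_in_subspace[OF assms(2,3)]) (simp_all add: assms that)
qed (simp_all add: assms)

lemmas scaleC_ring_simps = scaleC.scale_right_distrib scaleC.scale_right_diff_distrib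
  mult_scaleC_left mult_scaleC_right


section \<open>Vector calculus over a noncommutative algebra\<close>

definition dot :: "(3 \<Rightarrow> 'u::ring) \<Rightarrow> (3 \<Rightarrow> 'u) \<Rightarrow> 'u" where
  "dot u v = (\<Sum>i\<in>UNIV. u i * v i)"

text \<open>Indices in the type \<open>3\<close> are added modulo 3, so the formula is cyclic.
  Components of \<open>u\<close> stay to the left of those of \<open>v\<close>.\<close>

definition cross :: "(3 \<Rightarrow> 'u::ring) \<Rightarrow> (3 \<Rightarrow> 'u) \<Rightarrow> 3 \<Rightarrow> 'u" where
  "cross u v i = u (i + 1) * v (i + 2) - u (i + 2) * v (i + 1)"

text \<open>\<open>rot i u j\<close> is \<open>\<Sum>k. \<epsilon>\<^sub>i\<^sub>j\<^sub>k u\<^sub>k\<close>: the infinitesimal rotation about the \<open>i\<close>-th axis.\<close>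

definition rot :: "3 \<Rightarrow> (3 \<Rightarrow> 'u::ring) \<Rightarrow> 3 \<Rightarrow> 'u" where
  "rot i u j = (if j = i then 0 else if j = i + 1 then u (i + 2) else - u (i + 1))"

lemma three_wrap: "(4::3) = 1" "(5::3) = 2" "(6::3) = 3"
  by simp_all

text \<open>The equations between indices are oriented to \<open>True\<close> and
  \<open>False\<close> so that \<open>simp only\<close> can evaluate the case distinctions of
  \<open>rot\<close>.\<close>

lemma three_arith:
  "(1::3) + 1 = 2" "(1::3) + 2 = 3" "(2::3) + 1 = 3" "(2::3) + 2 = 1" "(3::3) + 1 = 1" "(3::3) + 2 = 2"
  "((1::3) = 1) = True" "((1::3) = 2) = False" "((1::3) = 3) = False"
  "((2::3) = 1) = False" "((2::3) = 2) = True" "((2::3) = 3) = False"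
  "((3::3) = 1) = False" "((3::3) = 2) = False" "((3::3) = 3) = True"
  by simp_all

text \<open>Contraction of two epsilon symbols. The term \<open>- u j * v k\<close> is split off
  because it will carry the Casimir eigenvalue; the rest is a dot product and an antisymmetric part
  that becomes a cross product.\<close>

lemma dot_rot:
  "(\<Sum>i\<in>UNIV. rot i u j * rot i v k) =
     (if j = k then dot u v else 0) - u j * v k + (u j * v k - u k * v j)"
  using exhaust_3[of j] exhaust_3[of k] by (auto simp: rot_def dot_def sum_3 three_wrap)

lemma antisymmetric_part_eq_cross:
  "u j * v k - u k * v j = rot j (cross u v) k"
proof -
  have "\<forall>j k. u j * v k - u k * v j = rot j (cross u v) k"
    unfolding forall_3 rot_def cross_def by (simp only: three_arith if_True if_False) simp
  then show ?thesis by blast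
qed

lemma dot_cross_assoc: "dot (cross u v) w = dot u (cross v w)"
  by (simp add: dot_def cross_def sum_3 three_wrap algebra_simps)

lemma rot_rot: "(\<Sum>i\<in>UNIV. rot i (rot i u) j) = - (u j + u j)"
  using exhaust_3[of j] by (auto simp: rot_def sum_3 three_wrap)

text \<open>The usual double cross product formula would move \<open>v l\<close> past
  \<open>u k\<close>; keeping the factors in order makes the identity exact.\<close>

lemma cross_cross:
  "cross u (cross v w) l = (\<Sum>k\<in>UNIV. u k * v l * w k) - dot u v * w l"
  using exhaust_3[of l] by (auto simp: cross_def dot_def sum_3 three_wrap algebra_simps)

lemma cross_cross':
  "cross (cross u v) w l = (\<Sum>k\<in>UNIV. u k * v l * w k) - u l * dot v w"
  using exhaust_3[of l] by (auto simp: cross_def dot_def sum_3 three_wrap algebra_simps)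


section \<open>Commuting families of spin operators\<close>

locale spin_algebra =
  fixes x :: "'n::finite \<Rightarrow> 3 \<Rightarrow> 'u::complex_algebra"
  assumes commute: "a \<noteq> b \<Longrightarrow> x a i * x b j = x b j * x a i"
    and bracket: "x a i * x a j - x a j * x a i = rot i (x a) j"
    and generate: "generated_algebra {x a i | a i. True} = UNIV"
begin

section \<open>The degree filtration, in which commutators lose one degree\<close>

definition filt :: "nat \<Rightarrow> 'u set" where
  "filt d = scaleC.span {prod_list (map (\<lambda>(a, i). x a i) w) | w. length w \<le> d}"

text \<open>Degree below \<open>d\<close>. Truncated subtraction would turn
  \<open>filt (0 - 1)\<close> into the scalars, hence the separate zero case.\<close>

definition low :: "nat \<Rightarrow> 'u set" where
  "low d = (if d = 0 then {0} else filt (d - 1))"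

lemma filt_subspace: "scaleC.subspace (filt d)"
  by (simp add: filt_def)

lemma low_subspace: "scaleC.subspace (low d)"
  by (simp add: low_def filt_subspace)

lemmas filt_closed = filt_subspace[THEN scaleC.subspace_add] filt_subspace[THEN scaleC.subspace_diff]
  filt_subspace[THEN scaleC.subspace_neg] filt_subspace[THEN scaleC.subspace_scale]
  filt_subspace[THEN scaleC.subspace_0] filt_subspace[THEN scaleC.subspace_sum]
lemmas low_closed = low_subspace[THEN scaleC.subspace_add] low_subspace[THEN scaleC.subspace_diff]
  low_subspace[THEN scaleC.subspace_neg] low_subspace[THEN scaleC.subspace_scale]
  low_subspace[THEN scaleC.subspace_0] low_subspace[THEN scaleC.subspace_sum]

lemma filt_mono: "c \<le> d \<Longrightarrow> filt c \<subseteq> filt d"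
  unfolding filt_def by (rule scaleC.span_mono) auto

lemma low_Suc [simp]: "low (Suc d) = filt d"
  by (simp add: low_def)

lemma low_le_filt: "low d \<subseteq> filt d"
  by (cases d) (auto simp: low_def filt_closed intro: filt_mono[THEN subsetD, rotated])

lemma low_mono: "c \<le> d \<Longrightarrow> low c \<subseteq> low d"
  by (cases c; cases d) (auto simp: low_def filt_closed filt_mono[THEN subsetD])

lemma one_filt: "1 \<in> filt d"
  unfolding filt_def by (rule scaleC.span_base) (auto intro!: exI[of _ "[]"])

lemma gen_filt: "x a i \<in> filt (Suc 0)"
  unfolding filt_def by (rule scaleC.span_base) (auto intro!: exI[of _ "[(a, i)]"])

lemma filt_mult: "y \<in> filt c \<Longrightarrow> z \<in> filt d \<Longrightarrow> y * z \<in> filt (c + d)"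
  unfolding filt_def[of c] filt_def[of d]
proof (erule span_bilinear_in_subspace, assumption)
  fix s t
  assume "s \<in> {prod_list (map (\<lambda>(a, i). x a i) w) | w. length w \<le> c}"
    and "t \<in> {prod_list (map (\<lambda>(a, i). x a i) w) | w. length w \<le> d}"
  then obtain v w where "s = prod_list (map (\<lambda>(a, i). x a i) v)" "length v \<le> c"
    "t = prod_list (map (\<lambda>(a, i). x a i) w)" "length w \<le> d"
    by blast
  then show "s * t \<in> filt (c + d)"
    unfolding filt_def by (intro scaleC.span_base) (auto intro!: exI[of _ "v @ w"])
qed (simp_all add: filt_subspace distrib_left distrib_right mult_scaleC_left mult_scaleC_right)

lemma low_mult_right: "y \<in> low c \<Longrightarrow> z \<in> filt d \<Longrightarrow> y * z \<in> low (c + d)"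
  by (cases c) (auto simp: low_def[of 0] low_closed intro: filt_mult)

lemma low_mult_left: "y \<in> filt c \<Longrightarrow> z \<in> low d \<Longrightarrow> y * z \<in> low (c + d)"
  by (cases d) (auto simp: low_def[of 0] low_closed intro: filt_mult)

text \<open>The commutator with \<open>x a i\<close> is a derivation and sends each letter to degree
  at most one, so the word length does not grow.\<close>

lemma gen_commutator_word:
  "x a i * prod_list (map (\<lambda>(b, j). x b j) w) - prod_list (map (\<lambda>(b, j). x b j) w) * x a i
     \<in> filt (length w)"
proof (induction w)
  case Nil
  then show ?case by (simp add: filt_closed)
next
  case (Cons p w)
  obtain b j where p: "p = (b, j)" by force
  let ?w = "prod_list (map (\<lambda>(b, j). x b j) w)"
  have "?w \<in> filt (length w)"
    unfolding filt_def by (rule scaleC.span_base) auto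
  moreover have "x a i * x b j - x b j * x a i \<in> filt (Suc 0)"
    by (cases "a = b") (auto simp: bracket commute rot_def gen_filt filt_closed)
  ultimately have "(x a i * x b j - x b j * x a i) * ?w \<in> filt (Suc 0 + length w)"
    by (blast intro: filt_mult)
  moreover have "x b j * (x a i * ?w - ?w * x a i) \<in> filt (Suc 0 + length w)"
    using Cons.IH by (blast intro: filt_mult gen_filt)
  ultimately have "(x a i * x b j - x b j * x a i) * ?w + x b j * (x a i * ?w - ?w * x a i)
      \<in> filt (Suc (length w))"
    using filt_closed(1) by simp
  then show ?case by (simp add: p algebra_simps)
qed

lemma gen_commutator:
  assumes "y \<in> filt d"
  shows "x a i * y - y * x a i \<in> filt d"
  using assms[unfolded filt_def] filt_subspace
proof (rule span_image_in_subspace)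
  fix s assume "s \<in> {prod_list (map (\<lambda>(a, i). x a i) w) | w. length w \<le> d}"
  then show "x a i * s - s * x a i \<in> filt d"
    using gen_commutator_word filt_mono by blast
qed (simp_all add: scaleC_ring_simps algebra_simps)

text \<open>Letters are peeled off a word for \<open>y\<close>; each contributes a commutator of
  \<open>z\<close> with a generator, which keeps the degree of \<open>z\<close> and so loses one
  overall. Hence the associated graded algebra is commutative.\<close>

lemma commutator_low:
  assumes "y \<in> filt c" and "z \<in> filt d"
  shows "y * z - z * y \<in> low (c + d)"
proof -
  have word: "prod_list (map (\<lambda>(b, j). x b j) w) * z - z * prod_list (map (\<lambda>(b, j). x b j) w)
      \<in> low (length w + d)" for w
  proof (induction w)
    case Nil
    then show ?case by (simp add: low_closed)
  next
    case (Cons p w)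
    obtain b j where p: "p = (b, j)" by force
    let ?w = "prod_list (map (\<lambda>(b, j). x b j) w)"
    have w: "?w \<in> filt (length w)"
      unfolding filt_def by (rule scaleC.span_base) auto
    have "x b j * (?w * z - z * ?w) \<in> low (Suc 0 + (length w + d))"
      by (rule low_mult_left[OF gen_filt Cons.IH])
    moreover have "(x b j * z - z * x b j) * ?w \<in> filt (d + length w)"
      by (rule filt_mult[OF gen_commutator[OF assms(2)] w])
    ultimately have "x b j * (?w * z - z * ?w) + (x b j * z - z * x b j) * ?w
        \<in> filt (length w + d)"
      using filt_closed(1) by (simp add: add.commute)
    then show ?case by (simp add: p algebra_simps)
  qed
  show ?thesis
    using assms(1)[unfolded filt_def] low_subspace
  proof (rule span_image_in_subspace)
    fix s assume "s \<in> {prod_list (map (\<lambda>(a, i). x a i) w) | w. length w \<le> c}"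
    then obtain w where "s = prod_list (map (\<lambda>(a, i). x a i) w)" "length w \<le> c" by blast
    then show "s * z - z * s \<in> low (c + d)"
      using word[of w] low_mono[of "length w + d" "c + d"] by auto
  qed (simp_all add: scaleC_ring_simps algebra_simps)
qed

lemma low_0 [simp]: "low 0 = {0}"
  by (simp add: low_def)

lemma filt_exhaust: "\<exists>d. y \<in> filt d"
proof -
  have "is_subalgebra (\<Union>d. filt d)"
    unfolding is_subalgebra_def
  proof (intro conjI ballI allI)
    show "0 \<in> (\<Union>d. filt d)" "1 \<in> (\<Union>d. filt d)"
      by (auto simp: filt_closed one_filt)
  next
    fix y z assume "y \<in> (\<Union>d. filt d)" "z \<in> (\<Union>d. filt d)"
    then obtain c d where y: "y \<in> filt c" and z: "z \<in> filt d" by blast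
    have "y \<in> filt (max c d)" "z \<in> filt (max c d)"
      using y z filt_mono[of c "max c d"] filt_mono[of d "max c d"] by auto
    then show "y + z \<in> (\<Union>d. filt d)" using filt_closed(1) by blast
    show "y * z \<in> (\<Union>d. filt d)" using filt_mult[OF y z] by blast
  next
    fix c y assume "y \<in> (\<Union>d. filt d)"
    then show "scaleC c y \<in> (\<Union>d. filt d)" using filt_closed(4) by blast
  qed
  then have "generated_algebra {x a i | a i. True} \<subseteq> (\<Union>d. filt d)"
    by (intro hull_minimal) (use gen_filt in auto)
  then show ?thesis unfolding generate by blast
qed

section \<open>Infinitesimal rotations as derivations, and their Casimir operator\<close>

definition D :: "3 \<Rightarrow> 'u \<Rightarrow> 'u" where
  "D i y = (\<Sum>a\<in>UNIV. x a i) * y - y * (\<Sum>a\<in>UNIV. x a i)"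

definition casimir :: "'u \<Rightarrow> 'u" where
  "casimir y = (\<Sum>i\<in>UNIV. D i (D i y))"

lemma D_add: "D i (y + z) = D i y + D i z"
  and D_diff: "D i (y - z) = D i y - D i z"
  and D_scaleC: "D i (scaleC c y) = scaleC c (D i y)"
  and D_mult: "D i (y * z) = D i y * z + y * D i z"
  and D_one: "D i 1 = 0"
  and D_zero: "D i 0 = 0"
  and D_uminus: "D i (- y) = - D i y"
  by (simp_all add: D_def scaleC_ring_simps algebra_simps)

lemma casimir_add: "casimir (y + z) = casimir y + casimir z"
  and casimir_scaleC: "casimir (scaleC c y) = scaleC c (casimir y)"
  by (simp_all add: casimir_def D_add D_scaleC sum.distrib scaleC.scale_sum_right)

text \<open>The Leibniz rule applied twice. All interaction between vectors sits in the mixed sum,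
  which \<open>mixed_casimir_nspan\<close> treats.\<close>

lemma casimir_mult:
  "casimir (y * z) = casimir y * z + scaleC 2 (\<Sum>i\<in>UNIV. D i y * D i z) + y * casimir z"
proof -
  have two: "scaleC 2 w = w + w" for w :: 'u
    using scaleC_add_left[of 1 1 w] by (simp add: scaleC_one)
  show ?thesis
    unfolding casimir_def two sum_3
    by (simp add: D_mult D_add algebra_simps)
qed

text \<open>Spins of other factors commute with \<open>x a j\<close>, so only the summand
  \<open>b = a\<close> survives and each \<open>x a\<close> rotates as a vector.\<close>

lemma D_gen: "D i (x a j) = rot i (x a) j"
proof -
  have "D i (x a j) = (\<Sum>b\<in>UNIV. x b i * x a j - x a j * x b i)"
    by (simp add: D_def sum_distrib_left sum_distrib_right sum_subtractf)
  also have "\<dots> = (\<Sum>b\<in>UNIV. if b = a then rot i (x a) j else 0)"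
    by (intro sum.cong refl) (auto simp: bracket commute)
  finally show ?thesis by simp
qed

lemma D_filt: "y \<in> filt d \<Longrightarrow> D i y \<in> filt d"
  using gen_commutator[of y d _ i] filt_closed(6)[of UNIV "\<lambda>a. x a i * y - y * x a i" d]
  by (simp add: D_def sum_distrib_left sum_distrib_right sum_subtractf)

lemma D_low: "y \<in> low d \<Longrightarrow> D i y \<in> low d"
  by (cases d) (simp_all add: D_zero D_filt)

lemma D_cross:
  assumes "\<And>i j. D i (u j) = rot i u j" and "\<And>i j. D i (v j) = rot i v j"
  shows "D i (cross u v j) = rot i (cross u v) j"
proof -
  have "\<forall>i j. D i (cross u v j) = rot i (cross u v) j"
    unfolding forall_3 cross_def
    by (simp only: three_arith D_diff D_mult assms rot_def if_True if_False cross_def)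
      (simp add: algebra_simps)
  then show ?thesis by blast
qed

lemma D_dot:
  assumes "\<And>i j. D i (u j) = rot i u j" and "\<And>i j. D i (v j) = rot i v j"
  shows "D i (dot u v) = 0"
proof -
  have "\<forall>i. D i (dot u v) = 0"
    unfolding forall_3 dot_def sum_3
    by (simp only: three_arith D_add D_mult assms rot_def if_True if_False) simp
  then show ?thesis by blast
qed

section \<open>Basic vectors and basic invariants, indexed by degree\<close>

inductive basic_vec :: "nat \<Rightarrow> (3 \<Rightarrow> 'u) \<Rightarrow> bool" where
  basic_vec_gen: "basic_vec 1 (x a)"
| basic_vec_cross: "basic_vec 2 (cross (x a) (x b))"

inductive basic_inv :: "nat \<Rightarrow> 'u \<Rightarrow> bool" where
  basic_inv_dot: "basic_inv 2 (dot (x a) (x b))"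
| basic_inv_det: "basic_inv 3 (dot (x a) (cross (x b) (x c)))"

lemma D_basic_vec: "basic_vec e u \<Longrightarrow> D i (u j) = rot i u j"
  by (induction rule: basic_vec.induct) (simp_all add: D_gen D_cross)

lemma D_basic_inv: "basic_inv e s \<Longrightarrow> D i s = 0"
  by (induction rule: basic_inv.induct) (intro D_dot D_cross D_gen)+

lemma cross_filt:
  assumes "\<And>j. u j \<in> filt c" and "\<And>j. v j \<in> filt d"
  shows "cross u v j \<in> filt (c + d)"
  unfolding cross_def using assms by (intro filt_closed filt_mult) auto

lemma dot_filt:
  assumes "\<And>j. u j \<in> filt c" and "\<And>j. v j \<in> filt d"
  shows "dot u v \<in> filt (c + d)"
  unfolding dot_def using assms by (intro filt_closed filt_mult) auto

lemma basic_vec_filt: "basic_vec e u \<Longrightarrow> u j \<in> filt e"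
proof (induction rule: basic_vec.induct)
  case (basic_vec_gen a)
  then show ?case using gen_filt by simp
next
  case (basic_vec_cross a b)
  then show ?case using cross_filt[of "x a" 1 "x b" 1] gen_filt by (simp add: numeral_2_eq_2)
qed

lemma basic_inv_filt: "basic_inv e s \<Longrightarrow> s \<in> filt e"
proof (induction rule: basic_inv.induct)
  case (basic_inv_dot a b)
  then show ?case using dot_filt[of "x a" 1 "x b" 1] gen_filt by (simp add: numeral_2_eq_2)
next
  case (basic_inv_det a b c)
  then show ?case
    using dot_filt[of "x a" 1 "cross (x b) (x c)" 2] basic_vec_filt[OF basic_vec_cross] gen_filt
    by (simp add: numeral_3_eq_3)
qed

section \<open>Monomials with \<open>m\<close> vector components and degree \<open>d\<close>, and
  their spans\<close>

inductive monomial :: "nat \<Rightarrow> nat \<Rightarrow> 'u \<Rightarrow> bool" where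
  monomial_one: "monomial 0 0 1"
| monomial_inv: "basic_inv c s \<Longrightarrow> monomial m d y \<Longrightarrow> monomial m (c + d) (s * y)"
| monomial_vec: "basic_vec e u \<Longrightarrow> monomial m d y \<Longrightarrow> monomial (Suc m) (e + d) (u j * y)"

text \<open>Strictly fewer than \<open>m\<close> vectors, so that \<open>nspan 0 d\<close> is just \<open>low d\<close>.\<close>

definition nspan :: "nat \<Rightarrow> nat \<Rightarrow> 'u set" where
  "nspan m d = scaleC.span ({y. \<exists>m'<m. \<exists>d'\<le>d. monomial m' d' y} \<union> low d)"

lemma nspan_subspace: "scaleC.subspace (nspan m d)"
  by (simp add: nspan_def)

lemmas nspan_closed = nspan_subspace[THEN scaleC.subspace_add] nspan_subspace[THEN scaleC.subspace_diff]
  nspan_subspace[THEN scaleC.subspace_neg] nspan_subspace[THEN scaleC.subspace_scale]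
  nspan_subspace[THEN scaleC.subspace_0] nspan_subspace[THEN scaleC.subspace_sum]

lemma monomial_filt: "monomial m d y \<Longrightarrow> y \<in> filt d"
  by (induction rule: monomial.induct) (simp_all add: one_filt filt_mult basic_inv_filt basic_vec_filt)

lemma monomial_nspan: "monomial m' d' y \<Longrightarrow> m' < m \<Longrightarrow> d' \<le> d \<Longrightarrow> y \<in> nspan m d"
  unfolding nspan_def by (rule scaleC.span_base) blast

lemma low_nspan: "low d \<subseteq> nspan m d"
  unfolding nspan_def by (meson scaleC.span_superset le_sup_iff)

lemma nspan_mono: "m \<le> m' \<Longrightarrow> d \<le> d' \<Longrightarrow> nspan m d \<subseteq> nspan m' d'"
  unfolding nspan_def
  by (intro scaleC.span_mono Un_mono low_mono) (auto intro: order_trans less_le_trans)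

lemma nspan_filt: "nspan m d \<subseteq> filt d"
  unfolding nspan_def
proof (rule scaleC.span_minimal)
  have "y \<in> filt d" if "monomial m' d' y" "d' \<le> d" for m' d' y
    using monomial_filt[OF that(1)] filt_mono[OF that(2)] by blast
  then show "{y. \<exists>m'<m. \<exists>d'\<le>d. monomial m' d' y} \<union> low d \<subseteq> filt d"
    using low_le_filt by auto
qed (rule filt_subspace)

lemma nspan_inv:
  assumes "basic_inv c s" and "y \<in> nspan m d"
  shows "s * y \<in> nspan m (c + d)"
  using assms(2)[unfolded nspan_def] nspan_subspace
proof (rule span_image_in_subspace)
  fix t assume "t \<in> {y. \<exists>m'<m. \<exists>d'\<le>d. monomial m' d' y} \<union> low d"
  then show "s * t \<in> nspan m (c + d)"
  proof
    assume "t \<in> {y. \<exists>m'<m. \<exists>d'\<le>d. monomial m' d' y}"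
    then show ?thesis using monomial_inv[OF assms(1)] by (force intro: monomial_nspan)
  next
    assume "t \<in> low d"
    then show ?thesis using low_mult_left[OF basic_inv_filt[OF assms(1)]] low_nspan by blast
  qed
qed (simp_all add: distrib_left mult_scaleC_right)

lemma nspan_vec:
  assumes "basic_vec e u" and "y \<in> nspan m d"
  shows "u j * y \<in> nspan (Suc m) (e + d)"
  using assms(2)[unfolded nspan_def] nspan_subspace
proof (rule span_image_in_subspace)
  fix t assume "t \<in> {y. \<exists>m'<m. \<exists>d'\<le>d. monomial m' d' y} \<union> low d"
  then show "u j * t \<in> nspan (Suc m) (e + d)"
  proof
    assume "t \<in> {y. \<exists>m'<m. \<exists>d'\<le>d. monomial m' d' y}"
    then show ?thesis using monomial_vec[OF assms(1)] by (force intro: monomial_nspan)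
  next
    assume "t \<in> low d"
    then show ?thesis using low_mult_left[OF basic_vec_filt[OF assms(1)]] low_nspan by blast
  qed
qed (simp_all add: distrib_left mult_scaleC_right)

lemma nspan_vec_inv:
  assumes "basic_vec e u" and "basic_inv c s" and "y \<in> nspan m d" and "e + c = k"
  shows "u j * s * y \<in> nspan (Suc m) (k + d)"
  using nspan_vec[OF assms(1) nspan_inv[OF assms(2,3)]] unfolding assms(4)[symmetric] by (simp add: mult.assoc add.assoc)

lemma nspan_inv_vec:
  assumes "basic_inv c s" and "basic_vec e u" and "y \<in> nspan m d" and "c + e = k"
  shows "s * u j * y \<in> nspan (Suc m) (k + d)"
  using nspan_inv[OF assms(1) nspan_vec[OF assms(2,3)]] unfolding assms(4)[symmetric] by (simp add: mult.assoc add.assoc)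

lemma nspan_inv_inv:
  assumes "basic_inv c s" and "basic_inv e t" and "y \<in> nspan m d" and "c + e = k"
  shows "s * t * y \<in> nspan m (k + d)"
  using nspan_inv[OF assms(1) nspan_inv[OF assms(2,3)]] unfolding assms(4)[symmetric] by (simp add: mult.assoc add.assoc)

section \<open>Contraction of two vectors, and the Casimir operator up to contractions\<close>

lemma nspan_cong:
  assumes "z - z' \<in> low c" and "y \<in> filt d" and "z' * y \<in> nspan m (c + d)"
  shows "z * y \<in> nspan m (c + d)"
proof -
  have "(z - z') * y \<in> nspan m (c + d)"
    using low_mult_right[OF assms(1,2)] low_nspan by blast
  from nspan_closed(1)[OF this assms(3)] show ?thesis by (simp add: algebra_simps)
qed

text \<open>The exact formulas differ from these by moving \<open>v l\<close> in front of
  \<open>u k\<close>, and that commutator has lower degree.\<close>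

lemma double_cross_low:
  assumes u: "\<And>j. u j \<in> filt c" and v: "\<And>j. v j \<in> filt d" and w: "\<And>j. w j \<in> filt e"
  shows "cross u (cross v w) l - (v l * dot u w - dot u v * w l) \<in> low (c + d + e)"
    and "cross (cross u v) w l - (v l * dot u w - u l * dot v w) \<in> low (c + d + e)"
proof -
  have "(\<Sum>k\<in>UNIV. (u k * v l - v l * u k) * w k) \<in> low (c + d + e)"
    using assms by (intro low_closed low_mult_right commutator_low)
  then have *: "(\<Sum>k\<in>UNIV. u k * v l * w k) - v l * dot u w \<in> low (c + d + e)"
    by (simp add: dot_def sum_distrib_left sum_subtractf[symmetric] algebra_simps)
  from * show "cross u (cross v w) l - (v l * dot u w - dot u v * w l) \<in> low (c + d + e)"
    by (simp add: cross_cross algebra_simps)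
  from * show "cross (cross u v) w l - (v l * dot u w - u l * dot v w) \<in> low (c + d + e)"
    by (simp add: cross_cross' algebra_simps)
qed

text \<open>Two crossed vectors count as one: two generators give a basic vector, and otherwise the
  double cross formulas leave single vectors times invariants, modulo lower degree.\<close>

lemma cross_nspan:
  assumes "basic_vec c u" and "basic_vec e v" and y: "y \<in> nspan m d"
  shows "cross u v l * y \<in> nspan (Suc m) (c + e + d)"
proof -
  have f: "y \<in> filt d" using y nspan_filt by blast
  have gens: "x a j \<in> filt 1" and vecs: "cross (x a) (x b) j \<in> filt 2" for a b j
    using gen_filt basic_vec_filt[OF basic_vec_cross] by simp_all
  from assms(1) show ?thesis
  proof cases
    case u: (basic_vec_gen a)
    from assms(2) show ?thesis
    proof cases
      case v: (basic_vec_gen b)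
      show ?thesis using nspan_vec[OF basic_vec_cross y] by (simp add: u v numeral_2_eq_2)
    next
      case v: (basic_vec_cross b b')
      let ?z = "x b l * dot (x a) (x b') - dot (x a) (x b) * x b' l"
      have "cross u v l - ?z \<in> low (c + e)"
        using double_cross_low(1)[of "x a" 1 "x b" 1 "x b'" 1 l] gens by (simp add: u v)
      moreover have "?z * y \<in> nspan (Suc m) (c + e + d)"
        unfolding left_diff_distrib
        by (intro nspan_closed(2) nspan_vec_inv[OF _ _ y] nspan_inv_vec[OF _ _ y])
          (auto simp: u v intro: basic_vec.intros basic_inv.intros)
      ultimately show ?thesis by (rule nspan_cong[OF _ f])
    qed
  next
    case u: (basic_vec_cross a a')
    from assms(2) show ?thesis
    proof cases
      case v: (basic_vec_gen b)
      let ?z = "x a' l * dot (x a) (x b) - x a l * dot (x a') (x b)"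
      have "cross u v l - ?z \<in> low (c + e)"
        using double_cross_low(2)[of "x a" 1 "x a'" 1 "x b" 1 l] gens by (simp add: u v numeral_3_eq_3)
      moreover have "?z * y \<in> nspan (Suc m) (c + e + d)"
        unfolding left_diff_distrib
        by (intro nspan_closed(2) nspan_vec_inv[OF _ _ y] nspan_inv_vec[OF _ _ y])
          (auto simp: u v intro: basic_vec.intros basic_inv.intros)
      ultimately show ?thesis by (rule nspan_cong[OF _ f])
    next
      case v: (basic_vec_cross b b')
      \<comment> \<open>Here \<open>v\<close> is kept whole as the third vector, so that both scalar
        factors are triple products.\<close>
      let ?z = "x a' l * dot (x a) v - x a l * dot (x a') v"
      have "cross u v l - ?z \<in> low (c + e)"
        using double_cross_low(2)[of "x a" 1 "x a'" 1 v 2 l] gens vecs by (simp add: u v eval_nat_numeral)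
      moreover have "?z * y \<in> nspan (Suc m) (c + e + d)"
        unfolding left_diff_distrib
        by (intro nspan_closed(2) nspan_vec_inv[OF _ _ y] nspan_inv_vec[OF _ _ y])
          (auto simp: u v intro: basic_vec.intros basic_inv.intros)
      ultimately show ?thesis by (rule nspan_cong[OF _ f])
    qed
  qed
qed

text \<open>Two dotted vectors leave only invariants. This is immediate unless both are cross
  products, where the Binet-Cauchy identity holds modulo lower degree.\<close>

lemma dot_nspan:
  assumes "basic_vec c u" and "basic_vec e v" and y: "y \<in> nspan m d"
  shows "dot u v * y \<in> nspan m (c + e + d)"
proof -
  have f: "y \<in> filt d" using y nspan_filt by blast
  have gens: "x a j \<in> filt 1" for a j
    using gen_filt by simp
  from assms(1) show ?thesis
  proof cases
    case u: (basic_vec_gen a)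
    from assms(2) show ?thesis
    proof cases
      case v: (basic_vec_gen b)
      show ?thesis using nspan_inv[OF basic_inv_dot y] by (simp add: u v numeral_2_eq_2)
    next
      case v: (basic_vec_cross b b')
      show ?thesis using nspan_inv[OF basic_inv_det y] by (simp add: u v numeral_3_eq_3)
    qed
  next
    case u: (basic_vec_cross a a')
    from assms(2) show ?thesis
    proof cases
      case v: (basic_vec_gen b)
      show ?thesis
        using nspan_inv[OF basic_inv_det y] by (simp add: u v dot_cross_assoc numeral_3_eq_3)
    next
      case v: (basic_vec_cross b b')
      let ?p = "dot (x a') (x b')" and ?q = "dot (x a') (x b)"
      let ?z = "dot (x a) (x b) * ?p - ?q * dot (x a) (x b')"
      have q: "?q \<in> filt 2"
        by (rule basic_inv_filt[OF basic_inv_dot])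
      \<comment> \<open>The product is read as the dot product of \<open>x a\<close> with
        \<open>cross (x a') v\<close>, which is then expanded; the next sum moves the scalar
        \<open>?q\<close> to the left of \<open>x a l\<close>.\<close>
      have "(\<Sum>l\<in>UNIV. x a l * (cross (x a') v l - (x b l * ?p - ?q * x b' l))) \<in> low (1 + (1 + 1 + 1))"
        unfolding v by (intro low_closed low_mult_left gens double_cross_low(1))
      moreover have "(\<Sum>l\<in>UNIV. (x a l * ?q - ?q * x a l) * x b' l) \<in> low (1 + 2 + 1)"
        by (intro low_closed low_mult_right commutator_low gens q)
      ultimately have "(\<Sum>l\<in>UNIV. x a l * (cross (x a') v l - (x b l * ?p - ?q * x b' l)))
          - (\<Sum>l\<in>UNIV. (x a l * ?q - ?q * x a l) * x b' l) \<in> low 4"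
        using low_closed(2)[of _ 4] by (simp add: eval_nat_numeral)
      moreover have "(\<Sum>l\<in>UNIV. x a l * (cross (x a') v l - (x b l * ?p - ?q * x b' l)))
          - (\<Sum>l\<in>UNIV. (x a l * ?q - ?q * x a l) * x b' l) = dot u v - ?z"
        unfolding u dot_cross_assoc sum_3
        unfolding dot_def[of _ "cross (x a') v"] dot_def[of "x a"] sum_3
        by (simp add: algebra_simps)
      ultimately have "dot u v - ?z \<in> low (c + e)"
        by (simp add: u v)
      moreover have "?z * y \<in> nspan m (c + e + d)"
        unfolding left_diff_distrib
        by (intro nspan_closed(2) nspan_inv_inv[OF _ _ y]) (auto simp: u v intro: basic_inv.intros)
      ultimately show ?thesis by (rule nspan_cong[OF _ f])
    qed
  qed
qed

text \<open>Each of the \<open>m\<close> vectors in \<open>y\<close> contributes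
  \<open>- u j * y\<close> through \<open>dot_rot\<close>. The other terms contract that vector with
  \<open>u\<close> and so have at most \<open>m\<close> vectors, which is what \<open>Suc m\<close>
  allows. Reordering factors costs only lower degree.\<close>

lemma mixed_casimir_nspan:
  assumes u: "basic_vec e u" and "monomial m d y"
  shows "(\<Sum>i\<in>UNIV. D i (u j) * D i y) + scaleC (of_nat m) (u j * y) \<in> nspan (Suc m) (e + d)"
  using assms(2)
proof (induction arbitrary: j)
  case monomial_one
  then show ?case by (simp add: D_one nspan_closed)
next
  case (monomial_inv c s m d y)
  let ?r = "\<lambda>y. (\<Sum>i\<in>UNIV. D i (u j) * D i y) + scaleC (of_nat m) (u j * y)"
  note s = basic_inv_filt[OF monomial_inv.hyps(1)]
  note y = monomial_filt[OF monomial_inv.hyps(2)]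
  note uj = basic_vec_filt[OF u]
  \<comment> \<open>The invariant \<open>s\<close> is moved to the front, at the price of
    commutators of lower degree.\<close>
  have "(\<Sum>i\<in>UNIV. (D i (u j) * s - s * D i (u j)) * D i y)
      + scaleC (of_nat m) ((u j * s - s * u j) * y) \<in> low (e + c + d)"
    by (intro low_closed low_mult_right commutator_low D_filt uj s y)
  moreover have "s * ?r y \<in> nspan (Suc m) (c + (e + d))"
    by (rule nspan_inv[OF monomial_inv.hyps(1) monomial_inv.IH])
  ultimately have "((\<Sum>i\<in>UNIV. (D i (u j) * s - s * D i (u j)) * D i y)
      + scaleC (of_nat m) ((u j * s - s * u j) * y)) + s * ?r y \<in> nspan (Suc m) (e + (c + d))"
    by (intro nspan_closed(1)[OF subsetD[OF low_nspan]])
      (simp_all only: add.assoc add.left_commute[of c e])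
  moreover have "((\<Sum>i\<in>UNIV. (D i (u j) * s - s * D i (u j)) * D i y)
      + scaleC (of_nat m) ((u j * s - s * u j) * y)) + s * ?r y = ?r (s * y)"
    unfolding sum_3 D_mult D_basic_inv[OF monomial_inv.hyps(1)]
    by (simp add: algebra_simps scaleC_ring_simps)
  ultimately show ?case by simp
next
  case (monomial_vec c v m d y k)
  let ?r = "\<lambda>n y. (\<Sum>i\<in>UNIV. D i (u j) * D i y) + scaleC (of_nat n) (u j * y)"
  note v = monomial_vec.hyps(1)
  note y = monomial_filt[OF monomial_vec.hyps(2)]
  note yn = monomial_nspan[OF monomial_vec.hyps(2) lessI order_refl]
  note uj = basic_vec_filt[OF u]
  have "(\<Sum>i\<in>UNIV. (D i (u j) * v k - v k * D i (u j)) * D i y)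
      + scaleC (of_nat m) ((u j * v k - v k * u j) * y) \<in> low (e + c + d)"
    by (intro low_closed low_mult_right commutator_low D_filt uj basic_vec_filt[OF v] y)
  then have 1: "(\<Sum>i\<in>UNIV. (D i (u j) * v k - v k * D i (u j)) * D i y)
      + scaleC (of_nat m) ((u j * v k - v k * u j) * y) \<in> nspan (Suc (Suc m)) (e + (c + d))"
    using low_nspan by (auto simp: ac_simps)
  have 2: "v k * ?r m y \<in> nspan (Suc (Suc m)) (e + (c + d))"
    using nspan_vec[OF v monomial_vec.IH] by (simp add: ac_simps)
  have cross: "cross u v l * y \<in> nspan (Suc (Suc m)) (e + (c + d))" for l
    using cross_nspan[OF u v yn] by (simp add: ac_simps)
  have "dot u v * y \<in> nspan (Suc (Suc m)) (e + (c + d))"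
    using dot_nspan[OF u v yn] nspan_mono[of "Suc m" "Suc (Suc m)"] by (auto simp: ac_simps)
  then have "(if j = k then dot u v * y else 0) \<in> nspan (Suc (Suc m)) (e + (c + d))"
    by (simp add: nspan_closed)
  moreover have "rot j (cross u v) k * y \<in> nspan (Suc (Suc m)) (e + (c + d))"
    using cross nspan_closed(3)[OF cross] by (auto simp: rot_def nspan_closed)
  ultimately have 3: "(if j = k then dot u v * y else 0) + rot j (cross u v) k * y
      \<in> nspan (Suc (Suc m)) (e + (c + d))"
    by (rule nspan_closed(1))
  \<comment> \<open>The new vector \<open>v\<close> raises the coefficient from \<open>m\<close> to
    \<open>Suc m\<close>: the extra \<open>u j * v k * y\<close> cancels against
    \<open>dot_rot\<close>, and only contractions remain.\<close>
  have 4: "(\<Sum>i\<in>UNIV. D i (u j) * D i (v k)) * y + u j * v k * y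
      = (if j = k then dot u v * y else 0) + rot j (cross u v) k * y"
    unfolding D_basic_vec[OF u] D_basic_vec[OF v] dot_rot antisymmetric_part_eq_cross
    by (simp add: algebra_simps)
  have "?r (Suc m) (v k * y) = ((\<Sum>i\<in>UNIV. (D i (u j) * v k - v k * D i (u j)) * D i y)
      + scaleC (of_nat m) ((u j * v k - v k * u j) * y)) + v k * ?r m y
      + ((\<Sum>i\<in>UNIV. D i (u j) * D i (v k)) * y + u j * v k * y)"
    unfolding sum_3 D_mult
    by (simp add: algebra_simps scaleC_ring_simps scaleC_add_left scaleC_one)
  then show ?case
    using nspan_closed(1)[OF nspan_closed(1)[OF 1 2] 3] unfolding 4 by simp
qed

text \<open>The eigenvalue is that of the Casimir operator on the spin-\<open>m\<close> representation.\<close>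

lemma casimir_monomial:
  assumes "monomial m d y"
  shows "casimir y + scaleC (of_nat (m * (m + 1))) y \<in> nspan m d"
  using assms
proof induction
  case monomial_one
  then show ?case by (simp add: casimir_def D_one D_zero nspan_closed)
next
  case (monomial_inv c s m d y)
  have "casimir s = 0"
    by (simp add: casimir_def D_basic_inv[OF monomial_inv.hyps(1)] D_zero)
  then have "casimir (s * y) + scaleC (of_nat (m * (m + 1))) (s * y) =
      s * (casimir y + scaleC (of_nat (m * (m + 1))) y)"
    unfolding casimir_mult
    by (simp add: D_basic_inv[OF monomial_inv.hyps(1)] scaleC_ring_simps distrib_left)
  then show ?case using nspan_inv[OF monomial_inv.hyps(1) monomial_inv.IH] by simp
next
  case (monomial_vec e u m d y j)
  note u = monomial_vec.hyps(1)
  let ?r = "(\<Sum>i\<in>UNIV. D i (u j) * D i y) + scaleC (of_nat m) (u j * y)"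
  have "D i (rot i u j) = rot i (rot i u) j" for i
    by (auto simp: rot_def D_basic_vec[OF u] D_uminus D_zero)
  then have "casimir (u j) = - (u j + u j)"
    unfolding casimir_def D_basic_vec[OF u] by (simp add: rot_rot)
  then have cas: "casimir (u j) = scaleC (-2) (u j)"
    using scaleC_add_left[of 1 1 "u j"] by (simp add: scaleC_one)
  have "scaleC 2 ?r \<in> nspan (Suc m) (e + d)"
    by (rule nspan_closed(4)[OF mixed_casimir_nspan[OF monomial_vec.hyps]])
  moreover have "u j * (casimir y + scaleC (of_nat (m * (m + 1))) y) \<in> nspan (Suc m) (e + d)"
    by (rule nspan_vec[OF u monomial_vec.IH])
  moreover have "casimir (u j * y) + scaleC (of_nat (Suc m * (Suc m + 1))) (u j * y)
      = scaleC 2 ?r + u j * (casimir y + scaleC (of_nat (m * (m + 1))) y)"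
  proof -
    \<comment> \<open>The eigenvalue grows by 2 from the vector \<open>u j\<close> itself and by
      \<open>2 * m\<close> from the mixed term.\<close>
    have "(of_nat (Suc m * (Suc m + 1)) :: complex) = 2 + (2 * of_nat m + of_nat (m * (m + 1)))"
      by (simp add: algebra_simps)
    then have "scaleC (of_nat (Suc m * (Suc m + 1))) (u j * y) = scaleC 2 (u j * y)
        + (scaleC 2 (scaleC (of_nat m) (u j * y)) + scaleC (of_nat (m * (m + 1))) (u j * y))"
      by (simp only: scaleC_add_left scaleC_scaleC)
    then show ?thesis
      unfolding casimir_mult cas
      by (simp only: scaleC_ring_simps distrib_left scaleC.scale_minus_left mult_minus_left) simp
  qed
  ultimately show ?case using nspan_closed(1) by simp
qed

text \<open>The Casimir operator kills \<open>y\<close>, so the congruence from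
  \<open>casimir_monomial\<close> reduces to the multiple \<open>m * (m + 1)\<close> of
  \<open>y\<close>, and this factor is invertible because \<open>m > 0\<close>.\<close>

lemma invariant_nspan_Suc:
  assumes inv: "\<And>i. D i y = 0" and y: "y \<in> nspan (Suc m) d" and "m > 0"
  shows "y \<in> nspan m d"
proof -
  have "casimir y + scaleC (of_nat (m * (m + 1))) y \<in> nspan m d"
    using y[unfolded nspan_def] nspan_subspace
  proof (rule span_image_in_subspace)
    fix t assume "t \<in> {y. \<exists>m'<Suc m. \<exists>d'\<le>d. monomial m' d' y} \<union> low d"
    then consider m' d' where "m' \<le> m" "d' \<le> d" "monomial m' d' t" | "t \<in> low d"
      by (auto simp: less_Suc_eq_le)
    then show "casimir t + scaleC (of_nat (m * (m + 1))) t \<in> nspan m d"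
    proof cases
      case 1
      then have *: "casimir t + scaleC (of_nat (m' * (m' + 1))) t \<in> nspan m d"
        using casimir_monomial nspan_mono by blast
      show ?thesis
      proof (cases "m' = m")
        \<comment> \<open>With fewer than \<open>m\<close> vectors the eigenvalue is a different
          one, but \<open>t\<close> and \<open>casimir t\<close> lie in \<open>nspan m d\<close>
          separately.\<close>
        case False
        then have t: "t \<in> nspan m d" using 1 by (auto intro: monomial_nspan)
        have "casimir t \<in> nspan m d"
          using nspan_closed(2)[OF * nspan_closed(4)[OF t, of "of_nat (m' * (m' + 1))"]] by simp
        then show ?thesis by (intro nspan_closed t)
      qed (use * in simp)
    next
      case 2
      then have "casimir t + scaleC (of_nat (m * (m + 1))) t \<in> low d"
        unfolding casimir_def by (intro low_closed D_low)
      then show ?thesis using low_nspan by blast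
    qed
  next
    fix y z
    show "casimir (y + z) + scaleC (of_nat (m * (m + 1))) (y + z) =
        casimir y + scaleC (of_nat (m * (m + 1))) y + (casimir z + scaleC (of_nat (m * (m + 1))) z)"
      by (simp add: casimir_add scaleC_add_right)
  next
    fix c y
    show "casimir (scaleC c y) + scaleC (of_nat (m * (m + 1))) (scaleC c y) =
        scaleC c (casimir y + scaleC (of_nat (m * (m + 1))) y)"
      by (simp add: casimir_scaleC scaleC_add_right scaleC_scaleC mult.commute)
  qed
  then have "scaleC (of_nat (m * (m + 1))) y \<in> nspan m d"
    by (simp add: casimir_def inv D_zero)
  then have "scaleC (inverse (of_nat (m * (m + 1)))) (scaleC (of_nat (m * (m + 1))) y) \<in> nspan m d"
    by (rule nspan_closed(4))
  moreover have "(of_nat (m * (m + 1)) :: complex) \<noteq> 0"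
    using \<open>m > 0\<close> unfolding of_nat_eq_0_iff by simp
  ultimately show ?thesis by (simp only: scaleC_scaleC left_inverse scaleC_one not_False_eq_True)
qed

section \<open>Generation of the invariants by dot and triple products\<close>

lemma filt_nspan: "filt d \<subseteq> nspan (Suc d) d"
  unfolding filt_def
proof (rule scaleC.span_minimal)
  have "monomial (length w) (length w) (prod_list (map (\<lambda>(a, i). x a i) w))" for w
  proof (induction w)
    case Nil
    then show ?case by (simp add: monomial_one)
  next
    case (Cons p w)
    then show ?case using monomial_vec[OF basic_vec_gen] by (auto split: prod.splits)
  qed
  then show "{prod_list (map (\<lambda>(a, i). x a i) w) | w. length w \<le> d} \<subseteq> nspan (Suc d) d"
    using monomial_nspan[of _ _ _ "Suc d" d] by (fastforce simp: less_Suc_eq_le)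
qed (rule nspan_subspace)

theorem invariants_generated:
  assumes B: "is_subalgebra B" and gens: "\<And>e s. basic_inv e s \<Longrightarrow> s \<in> B"
    and inv: "\<And>i. D i y = 0"
  shows "y \<in> B"
proof -
  note B' = B[unfolded is_subalgebra_def]
  \<comment> \<open>Monomials without vectors, in the form in which they occur in
    \<open>nspan 1 d\<close>.\<close>
  let ?P = "\<lambda>d. {y. \<exists>m'<1. \<exists>d'\<le>d. monomial m' d' y}"
  let ?I = "{y \<in> B. \<forall>i. D i y = 0}"
  have mon: "y \<in> ?I" if "monomial m d y" "m = 0" for m d y
    using that by induction (use B' gens in \<open>auto simp: D_one D_mult D_basic_inv\<close>)
  have "scaleC.subspace ?I"
    using B' by (auto simp: scaleC.subspace_def D_zero D_add D_scaleC)
  then have P: "scaleC.span (?P d) \<subseteq> ?I" for d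
    by (intro scaleC.span_minimal) (use mon in auto)
  have low: "y \<in> B" if "y \<in> low d" "\<And>i. D i y = 0" for y d
    using that
  proof (induction d arbitrary: y)
    case 0
    then show ?case using B' by simp
  next
    case (Suc d)
    \<comment> \<open>Descent in the number of vectors until none is left; \<open>nspan 1 d\<close>
      still contains \<open>low d\<close>.\<close>
    have "y \<in> nspan (Suc m) d \<Longrightarrow> y \<in> nspan 1 d" for m
      by (induction m) (auto intro: invariant_nspan_Suc Suc.prems(2))
    then have "y \<in> nspan 1 d"
      using filt_nspan Suc.prems(1) by auto
    then obtain b l where y: "y = b + l" and b: "b \<in> scaleC.span (?P d)" and l: "l \<in> scaleC.span (low d)"
      unfolding nspan_def scaleC.span_Un by blast
    \<comment> \<open>As a combination of products of basic invariants, \<open>b\<close> is itself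
      invariant. Hence so is the remainder \<open>l\<close>, and the induction on the degree applies
      to it.\<close>
    have "b \<in> ?I" using b P by blast
    moreover have "l \<in> low d" using l low_subspace scaleC.span_eq_iff by blast
    moreover from calculation have "D i l = 0" for i
      using Suc.prems(2)[of i] by (simp add: y D_add)
    ultimately show ?case
      unfolding y using Suc.IH B' by blast
  qed
  obtain d where "y \<in> low (Suc d)" using filt_exhaust[of y] by auto
  then show ?thesis using low inv by blast
qed

section \<open>Symmetries of dot and triple products\<close>

lemma dot_commute: "a \<noteq> b \<Longrightarrow> dot (x a) (x b) = dot (x b) (x a)"
  by (simp add: dot_def commute)

text \<open>The components of \<open>cross (x a) (x a)\<close> are commutators, which
  \<open>bracket\<close> evaluates.\<close>

lemma cross_self: "cross (x a) (x a) = x a"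
proof -
  have "\<forall>i. cross (x a) (x a) i = x a i"
    unfolding forall_3 cross_def bracket by (simp add: rot_def three_arith three_wrap)
  then show ?thesis by blast
qed

text \<open>Components of different factors commute, so exchanging two neighbouring vectors only
  reverses the sign of their cross product.\<close>

lemma det_swap:
  shows "a \<noteq> b \<Longrightarrow> dot (x a) (cross (x b) (x c)) = - dot (x b) (cross (x a) (x c))"
    and "b \<noteq> c \<Longrightarrow> dot (x a) (cross (x b) (x c)) = - dot (x a) (cross (x c) (x b))"
proof -
  have *: "cross (x p) (x q) i = - cross (x q) (x p) i" if "p \<noteq> q" for p q i
    using that by (simp add: cross_def commute)
  show "dot (x a) (cross (x b) (x c)) = - dot (x b) (cross (x a) (x c))" if "a \<noteq> b"
    unfolding dot_cross_assoc[symmetric] unfolding dot_def *[OF that] by (simp add: sum_negf)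
  show "dot (x a) (cross (x b) (x c)) = - dot (x a) (cross (x c) (x b))" if "b \<noteq> c"
    unfolding dot_def *[OF that] by (simp add: sum_negf)
qed

lemma det_repeated:
  "dot (x a) (cross (x a) (x c)) = dot (x a) (x c)"
  "dot (x a) (cross (x b) (x b)) = dot (x a) (x b)"
  by (simp_all add: dot_cross_assoc[symmetric] cross_self)

end


section \<open>The spin basis of $\mathfrak{sl}_2$\<close>

text \<open>Half the Pauli matrices divided by \<open>\<i>\<close>.\<close>

definition spin :: "3 \<Rightarrow> usl2" where
  "spin i = (if i = 1 then scaleC (- \<i> / 2) (sl2_e 1 2 + sl2_e 2 1)
     else if i = 2 then scaleC (- 1 / 2) (sl2_e 1 2 - sl2_e 2 1)
     else scaleC (- \<i>) (sl2_e 1 1))"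

lemma sl2_e_eq_spin:
  "sl2_e 1 2 = scaleC \<i> (spin 1) - spin 2"
  "sl2_e 2 1 = scaleC \<i> (spin 1) + spin 2"
  "sl2_e 1 1 = scaleC \<i> (spin 3)"
  "sl2_e 2 2 = - scaleC \<i> (spin 3)"
proof -
  have half: "scaleC (1/2) w + scaleC (1/2) w = w" for w :: usl2
    by (simp add: scaleC_add_left[symmetric] scaleC_one)
  show "sl2_e 1 2 = scaleC \<i> (spin 1) - spin 2" "sl2_e 2 1 = scaleC \<i> (spin 1) + spin 2"
    by (simp_all add: spin_def scaleC_scaleC scaleC_ring_simps half algebra_simps)
  show 11: "sl2_e 1 1 = scaleC \<i> (spin 3)"
    by (simp add: spin_def scaleC_scaleC scaleC_one)
  show "sl2_e 2 2 = - scaleC \<i> (spin 3)"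
    using sl2_e_trace unfolding 11[symmetric] by (simp add: eq_neg_iff_add_eq_0 add.commute)
qed

lemma spin_bracket: "spin i * spin j - spin j * spin i = rot i spin j"
proof -
  have scaled: "scaleC c v * scaleC d w - scaleC d w * scaleC c v = scaleC (c * d) (v * w - w * v)"
    for c d and v w :: usl2
    by (simp add: mult_scaleC_left mult_scaleC_right scaleC_scaleC scaleC_ring_simps mult.commute[of d])
  let ?E = "sl2_e 1 2" and ?F = "sl2_e 2 1" and ?H = "sl2_e 1 1"
  have 22: "sl2_e 2 2 = - ?H"
    using sl2_e_trace by (simp add: eq_neg_iff_add_eq_0 add.commute)
  \<comment> \<open>Since \<open>sl2_e 2 2 = - ?H\<close>, the element \<open>?H\<close> is half the
    usual Cartan generator.\<close>
  have EF: "?E * ?F = ?F * ?E + (?H + ?H)" and HE: "?H * ?E = ?E * ?H + ?E"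
    and HF: "?H * ?F = ?F * ?H - ?F"
    using sl2_e_commutator[of 1 2 2 1] sl2_e_commutator[of 1 1 1 2] sl2_e_commutator[of 1 1 2 1]
    by (simp_all add: 22 algebra_simps)
  have 12: "spin 1 * spin 2 - spin 2 * spin 1 = spin 3"
  proof -
    have "(?E + ?F) * (?E - ?F) - (?E - ?F) * (?E + ?F) = - (?H + ?H + ?H + ?H)"
      by (simp add: algebra_simps EF)
    also have "\<dots> = scaleC (-4) ?H"
      using scaleC_add_left[of 2 2 ?H] scaleC_add_left[of 1 1 ?H] by (simp add: scaleC_one)
    finally show ?thesis by (simp add: spin_def scaled scaleC_scaleC)
  qed
  have 23: "spin 2 * spin 3 - spin 3 * spin 2 = spin 1"
  proof -
    have "(?E - ?F) * ?H - ?H * (?E - ?F) = - (?E + ?F)"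
      by (simp add: algebra_simps HE HF)
    moreover have "spin 2 * spin 3 - spin 3 * spin 2 = scaleC (\<i> / 2) ((?E - ?F) * ?H - ?H * (?E - ?F))"
      by (simp add: spin_def scaled)
    ultimately show ?thesis
      by (simp add: spin_def scaleC.scale_minus_right del: minus_add_distrib)
  qed
  have 31: "spin 3 * spin 1 - spin 1 * spin 3 = spin 2"
  proof -
    have "?H * (?E + ?F) - (?E + ?F) * ?H = ?E - ?F"
      by (simp add: algebra_simps HE HF)
    then show ?thesis by (simp add: spin_def scaled scaleC_scaleC)
  qed
  have "\<forall>i j. spin i * spin j - spin j * spin i = rot i spin j"
    unfolding forall_3 rot_def three_arith
    using 12 23 31 by (auto simp: algebra_simps)
  then show ?thesis by blast
qed

section \<open>The spins generate the enveloping algebra and its tensor powers\<close>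

lemma is_subalgebra_closed:
  assumes "is_subalgebra A"
  shows "0 \<in> A" "1 \<in> A" "y \<in> A \<Longrightarrow> z \<in> A \<Longrightarrow> y + z \<in> A" "y \<in> A \<Longrightarrow> z \<in> A \<Longrightarrow> y * z \<in> A"
    "y \<in> A \<Longrightarrow> scaleC c y \<in> A" "y \<in> A \<Longrightarrow> - y \<in> A" "y \<in> A \<Longrightarrow> z \<in> A \<Longrightarrow> y - z \<in> A"
proof -
  note A = assms[unfolded is_subalgebra_def]
  show "0 \<in> A" "1 \<in> A" "y \<in> A \<Longrightarrow> z \<in> A \<Longrightarrow> y * z \<in> A"
    and add: "\<And>y z. y \<in> A \<Longrightarrow> z \<in> A \<Longrightarrow> y + z \<in> A"
    and scale: "\<And>c y. y \<in> A \<Longrightarrow> scaleC c y \<in> A"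
    using A by blast+
  show neg: "- y \<in> A" if "y \<in> A" for y
    using scale[OF that, of "- 1"] by (simp add: scaleC_one)
  show "y - z \<in> A" if "y \<in> A" "z \<in> A"
    using add[OF that(1) neg[OF that(2)]] by simp
qed

lemma is_subalgebra_generated: "is_subalgebra (generated_algebra S)"
  by (rule hull_in) (auto simp: is_subalgebra_def)

lemma usl2_generated:
  assumes A: "is_subalgebra A" and "\<And>i. spin i \<in> A"
  shows "u \<in> A"
proof -
  note closed = is_subalgebra_closed[OF A]
  have e: "sl2_e i j \<in> A" for i j
    using exhaust_2[of i] exhaust_2[of j] by (auto simp: sl2_e_eq_spin closed assms)
  have word: "abs_usl2 (monom (Letters w)) \<in> A" for w
  proof (induction w)
    case Nil
    then show ?case
      using closed(2) unfolding one_usl2_def by (simp add: zero_free_monoid_def[symmetric])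
  next
    case (Cons p w)
    have "monom (Letters (p # w)) = free_gen p * monom (Letters w)"
      by (simp add: free_gen_def mult_single plus_free_monoid_def)
    then have "abs_usl2 (monom (Letters (p # w))) = sl2_e (fst p) (snd p) * abs_usl2 (monom (Letters w))"
      by (simp add: times_usl2.abs_eq sl2_e.abs_eq)
    then show ?case using closed(4)[OF e Cons.IH] by simp
  qed
  have single: "abs_usl2 (Poly_Mapping.single w c) \<in> A" for w c
  proof -
    have "Poly_Mapping.single w c = scalar c * monom (Letters (letters w))"
      by (simp add: mult_single)
    then show ?thesis
      using closed(5)[OF word, of c "letters w"] by (simp add: scaleC_usl2.abs_eq)
  qed
  have sum: "abs_usl2 (\<Sum>w\<in>W. Poly_Mapping.single w (f w)) \<in> A" for W and f
    by (induction W rule: infinite_finite_induct)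
      (use closed single in \<open>auto simp: zero_usl2_def[symmetric] plus_usl2.abs_eq[symmetric]\<close>)
  have "abs_usl2 p \<in> A" for p
    by (subst monoid_algebra_expand) (rule sum)
  then show ?thesis by (rule usl2.abs_induct)
qed

lemma tensor_power_generated:
  fixes t :: "(usl2, 'n::finite) tensor_power"
  assumes A: "is_subalgebra A" and gens: "\<And>a i. in_factor a (spin i) \<in> A"
  shows "t \<in> A"
proof -
  note closed = is_subalgebra_closed[OF A]
  have factor: "in_factor a u \<in> A" for a u
  proof -
    have "is_subalgebra {u. in_factor a u \<in> A}"
      using closed by (auto simp: is_subalgebra_def in_factor_zero in_factor_one in_factor_add
          in_factor_mult in_factor_scaleC)
    then show ?thesis using usl2_generated[of "{u. in_factor a u \<in> A}" u] gens by blast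
  qed
  \<comment> \<open>A pure tensor is built up one factor at a time; \<open>S\<close> is the set of
    positions already filled.\<close>
  have "pure_tensor (\<lambda>a. if a \<in> S then f a else 1) \<in> A" for S and f :: "'n \<Rightarrow> usl2"
    using finite[of S]
  proof induction
    case empty
    then show ?case using closed by (simp add: pure_tensor_one)
  next
    case (insert b S)
    have "pure_tensor (\<lambda>a. if a \<in> insert b S then f a else 1) =
        in_factor b (f b) * pure_tensor (\<lambda>a. if a \<in> S then f a else 1)"
      unfolding in_factor_def pure_tensor_mult
      by (rule arg_cong[of _ _ pure_tensor]) (use insert.hyps in auto)
    then show ?case using closed(4)[OF factor insert.IH] by simp
  qed
  from this[of UNIV] have pure: "pure_tensor f \<in> A" for f :: "'n \<Rightarrow> usl2"
    by simp
  have single: "abs_tensor_power (Poly_Mapping.single w c) \<in> A" for w c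
  proof -
    have "Poly_Mapping.single w c = scalar c * monom (Tuple (component w))"
      by (simp add: mult_single)
    then show ?thesis
      using closed(5)[OF pure, of c "component w"]
      by (simp add: scaleC_tensor_power.abs_eq pure_tensor.abs_eq)
  qed
  have sum: "abs_tensor_power (\<Sum>w\<in>W. Poly_Mapping.single w (f w)) \<in> A" for W f
    by (induction W rule: infinite_finite_induct)
      (use closed single in
        \<open>auto simp: zero_tensor_power_def[symmetric] plus_tensor_power.abs_eq[symmetric]\<close>)
  have "abs_tensor_power p \<in> A" for p
    by (subst monoid_algebra_expand) (rule sum)
  then show ?thesis by (rule tensor_power.abs_induct)
qed

section \<open>The tensor power as a spin algebra, and the traces in spin coordinates\<close>

lemma in_factor_uminus: "in_factor a (- u) = - in_factor a u"
  using in_factor_diff[of a 0 u] by (simp add: in_factor_zero)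

abbreviation spin_at :: "'n \<Rightarrow> 3 \<Rightarrow> (usl2, 'n) tensor_power" where
  "spin_at a i \<equiv> in_factor a (spin i)"

global_interpretation sl2: spin_algebra "spin_at :: 'n::finite \<Rightarrow> _"
proof
  show "spin_at a i * spin_at b j = spin_at b j * spin_at a i" if "a \<noteq> b" for a b :: 'n and i j
    using that by (rule in_factor_commute)
  have "in_factor a (rot i spin j) = rot i (spin_at a) j" for a :: 'n and i j
    by (simp add: rot_def in_factor_zero in_factor_uminus)
  then show "spin_at a i * spin_at a j - spin_at a j * spin_at a i = rot i (spin_at a) j"
    for a :: 'n and i j
    by (simp add: in_factor_mult[symmetric] in_factor_diff[symmetric] spin_bracket)
  let ?G = "{spin_at (a :: 'n) i | a i. True}"
  have "t \<in> generated_algebra ?G" for t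
    by (rule tensor_power_generated[OF is_subalgebra_generated]) (auto intro: hull_inc)
  then show "generated_algebra ?G = UNIV" by blast
qed

text \<open>By \<open>sl2_e_eq_spin\<close>, \<open>sl2_e i j\<close> is \<i> times the sum over
  \<open>k\<close> of the entry (j, i) of the k-th Pauli matrix times \<open>spin k\<close>. A
  product of two Pauli matrices has trace twice a Kronecker delta, and the square of \<i> gives the
  sign.\<close>

lemma polarized_trace_2_eq_dot:
  "polarized_trace [a, b] = - (dot (spin_at a) (spin_at b) + dot (spin_at a) (spin_at b))"
  unfolding polarized_trace_2 dot_def sum_2 sum_3 sl2_e_eq_spin in_factor_add in_factor_diff
    in_factor_uminus in_factor_scaleC
  by (simp add: algebra_simps scaleC_ring_simps scaleC_scaleC scaleC_one)

text \<open>A product of three Pauli matrices has trace \<open>2 * \<i>\<close> times an epsilon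
  symbol, and the cube of \<i> in front turns this factor into 2.\<close>

lemma polarized_trace_3_eq_det:
  "polarized_trace [a, b, c] =
     dot (spin_at a) (cross (spin_at b) (spin_at c)) + dot (spin_at a) (cross (spin_at b) (spin_at c))"
  unfolding polarized_trace_3 dot_def cross_def sum_2 sum_3 three_arith sl2_e_eq_spin in_factor_add
    in_factor_diff in_factor_uminus in_factor_scaleC
  by (simp add: algebra_simps scaleC_ring_simps scaleC_scaleC scaleC_one)

section \<open>The centralizer as the common kernel of the rotations\<close>

lemma diagonal_spin:
  "(diagonal (spin i) :: (usl2, 'n::finite) tensor_power) = (\<Sum>a\<in>UNIV. spin_at a i)"
proof -
  have neg: "(diagonal (- u) :: (usl2, 'n) tensor_power) = - diagonal u" for u
    using diagonal_hom(4)[of "-1" u] by (simp add: scaleC_one)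
  have "(diagonal (u - v) :: (usl2, 'n) tensor_power) = diagonal u - diagonal v" for u v
    unfolding diff_conv_add_uminus diagonal_hom(1) neg ..
  then show ?thesis
    by (simp add: spin_def neg in_factor_uminus sum_negf diagonal_hom diagonal_e in_factor_add in_factor_diff in_factor_scaleC
        sum.distrib sum_subtractf scaleC.scale_sum_right scaleC_ring_simps)
qed

text \<open>For fixed \<open>X\<close>, the \<open>g\<close> whose image \<open>diagonal g\<close>
  commutes with \<open>X\<close> form a subalgebra, so it suffices to test the generators
  \<open>spin i\<close>.\<close>

lemma centralizer_iff_D:
  fixes X :: "(usl2, 'n::finite) tensor_power"
  shows "X \<in> centralizer \<longleftrightarrow> (\<forall>i. sl2.D i X = 0)"
proof
  assume "X \<in> centralizer"
  then show "\<forall>i. sl2.D i X = 0"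
    unfolding sl2.D_def centralizer_def diagonal_spin[symmetric] by simp
next
  assume "\<forall>i. sl2.D i X = 0"
  then have "diagonal (spin i) * X = X * diagonal (spin i)" for i
    unfolding sl2.D_def diagonal_spin[symmetric] by simp
  moreover have "is_subalgebra {g. diagonal g * X = X * diagonal g}"
  proof -
    have "diagonal (g * h) * X = X * diagonal (g * h)"
      if "diagonal g * X = X * diagonal g" "diagonal h * X = X * diagonal h" for g h
      by (metis diagonal_hom(2) mult.assoc that)
    moreover have "(diagonal 0 :: (usl2, 'n) tensor_power) = 0"
      using diagonal_hom(4)[of 0 0] by simp
    ultimately show ?thesis
      unfolding is_subalgebra_def mem_Collect_eq
      by (auto simp: diagonal_hom(1,3,4) scaleC_ring_simps distrib_left distrib_right)
  qed
  ultimately show "X \<in> centralizer"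
    unfolding centralizer_def using usl2_generated by fastforce
qed

text \<open>Symmetry sorts the indices, triple products with a repeated index collapse to dot
  products, and halving the traces yields the sorted ones.\<close>

lemma basic_inv_in_subalgebra:
  fixes A :: "(usl2, 'n::{finite, linorder}) tensor_power set"
  assumes A: "is_subalgebra A"
    and T2: "\<And>a b. a \<le> b \<Longrightarrow> polarized_trace [a, b] \<in> A"
    and T3: "\<And>a b c. a < b \<Longrightarrow> b < c \<Longrightarrow> polarized_trace [a, b, c] \<in> A"
    and s: "sl2.basic_inv e s"
  shows "s \<in> A"
proof -
  note closed = is_subalgebra_closed[OF A]
  have half: "y \<in> A" if "y + y \<in> A" for y
  proof -
    have "scaleC (1/2) (y + y) = y"
      by (simp only: scaleC_add_right) (simp add: scaleC_add_left[symmetric] scaleC_one)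
    then show ?thesis using closed(5)[OF that, of "1/2"] by simp
  qed
  have dot_le: "dot (spin_at a) (spin_at b) \<in> A" if "a \<le> b" for a b
  proof -
    have "polarized_trace [a, b] \<in> A" by (rule T2[OF that])
    from closed(6)[OF this] show ?thesis
      unfolding polarized_trace_2_eq_dot[of a b] minus_minus by (rule half)
  qed
  then have dot: "dot (spin_at a) (spin_at b) \<in> A" for a b
    using sl2.dot_commute[of a b] by (metis linear)
  let ?det = "\<lambda>a b c :: 'n. dot (spin_at a) (cross (spin_at b) (spin_at c))"
  have det_less: "?det a b c \<in> A" if "a < b" "b < c" for a b c
  proof -
    have "polarized_trace [a, b, c] \<in> A" by (rule T3[OF that])
    then show ?thesis unfolding polarized_trace_3_eq_det[of a b c] by (rule half)
  qed
  have swap: "?det a b c \<in> A" if "?det b a c \<in> A" for a b c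
    using that closed(6)[OF that] sl2.det_swap(1)[of a b c] by metis
  have swap': "?det a b c \<in> A" if "?det a c b \<in> A" for a b c
    using that closed(6)[OF that] sl2.det_swap(2)[of b c a] by metis
  have repeated: "?det a a c \<in> A" "?det a b b \<in> A" for a b c
    using dot by (simp_all add: sl2.det_repeated)
  have det: "?det a b c \<in> A" for a b c
  proof -
    consider "a = b \<or> b = c" | "a = c" | "a < b" "b < c" | "a < c" "c < b" | "b < a" "a < c"
      | "b < c" "c < a" | "c < a" "a < b" | "c < b" "b < a"
      by (cases a b rule: linorder_cases; cases b c rule: linorder_cases;
          cases a c rule: linorder_cases) auto
    then show ?thesis
    proof cases
      case 1
      then show ?thesis using repeated by auto
    next
      case 2
      \<comment> \<open>Exchanging the first two vectors makes the equal ones adjacent.\<close>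
      then show ?thesis using swap[OF repeated(2)] by simp
    next
      case 3
      then show ?thesis by (rule det_less)
    next
      case 4
      then show ?thesis by (rule swap'[OF det_less])
    next
      case 5
      then show ?thesis by (rule swap[OF det_less])
    next
      case 6
      then show ?thesis by (rule swap[OF swap'[OF det_less]])
    next
      case 7
      then show ?thesis by (rule swap'[OF swap[OF det_less]])
    next
      case 8
      then show ?thesis by (rule swap[OF swap'[OF swap[OF det_less]]])
    qed
  qed
  from s show ?thesis
    by cases (simp_all add: dot det)
qed

theorem corollary5p5:
  shows "generated_algebra
           ({polarized_trace [i, j] | i j. i \<le> j} \<union>
            {polarized_trace [i, j, k] | i j k. i < j \<and> j < k})
         = (centralizer :: (usl2, 'n::{finite, linorder}) tensor_power set)"
    (is "generated_algebra ?T = _")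
proof
  \<comment> \<open>The easy inclusion: the centralizer is a subalgebra, and the traces are
    multiples of rotation-invariant dot and triple products.\<close>
  have "is_subalgebra (centralizer :: (usl2, 'n) tensor_power set)"
    by (simp add: is_subalgebra_def centralizer_iff_D sl2.D_zero sl2.D_one sl2.D_add sl2.D_mult
        sl2.D_scaleC)
  moreover have "sl2.D i (dot (spin_at a) (spin_at b)) = 0"
    "sl2.D i (dot (spin_at a) (cross (spin_at b) (spin_at c))) = 0" for i and a b c :: 'n
    by (intro sl2.D_basic_inv[OF sl2.basic_inv_dot] sl2.D_basic_inv[OF sl2.basic_inv_det])+
  ultimately show "generated_algebra ?T \<subseteq> centralizer"
    by (intro hull_minimal) (auto simp: centralizer_iff_D polarized_trace_2_eq_dot
        polarized_trace_3_eq_det sl2.D_add sl2.D_diff sl2.D_uminus)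
next
  let ?A = "generated_algebra ?T"
  have T2: "polarized_trace [a, b] \<in> ?A" if "a \<le> b" for a b
    by (rule hull_inc) (use that in blast)
  have T3: "polarized_trace [a, b, c] \<in> ?A" if "a < b" "b < c" for a b c
    by (rule hull_inc) (use that in blast)
  show "centralizer \<subseteq> ?A"
  proof
    fix y :: "(usl2, 'n) tensor_power" assume "y \<in> centralizer"
    then have inv: "sl2.D i y = 0" for i
      unfolding centralizer_iff_D by blast
    have "s \<in> ?A" if "sl2.basic_inv e s" for e s
      using is_subalgebra_generated T2 T3 that by (rule basic_inv_in_subalgebra)
    then show "y \<in> ?A"
      by (rule sl2.invariants_generated[OF is_subalgebra_generated _ inv])
  qed
qed

end
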